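(* Let $n\ge 2$ and $F=x^2(y_1^2+\cdots+y_n^2)\in\mathbb{C}[x,y_1,\ldots,y_n]$. Then the cactus rank and the border rank of $F$ satisfy $$\operatorname{cr}F=\operatorname{brk}F=n+2.$$
   Context: Let $T=\mathbb{C}[X,Y_1,\ldots,Y_n]$ act on $S=\mathbb{C}[x,y_1,\ldots,y_n]$ by differentiation ($X=\partial/\partial x$, $Y_j=\partial/\partial y_j$), and for a form $F\in S$ let $F^\perp=\{g\in T: g\circ F=0\}$. $T$ is also the homogeneous coordinate ring of $\mathbb{P}^n$. The cactus rank $\operatorname{cr}F$ is the minimum length of a zero-dimensional closed subscheme $\mathbb{X}\subset\mathbb{P}^n$ whose saturated homogeneous ideal satisfies $I(\mathbb{X})\subseteq F^\perp$. The Waring rank of a form $G$ of degree $d$ is the least $r$ such that $G=\sum_{i=1}^r\alpha_iL_i^d$ with $\alpha_i\in\mathbb{C}$, $L_i$ linear forms. The border rank $\operatorname{brk}F$ is the smallest $r$ such that $F$ is a limit of forms of Waring rank $r$. *)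

theory Defs
  imports Complex_Main "HOL-Library.Poly_Mapping" "HOL-Library.Cardinality"
    "HOL-Library.Extended_Nat"
begin

text \<open>
  Polynomials over the complex numbers in the variables indexed by a finite type \<open>'v\<close>.
  The type serves both for \<open>S\<close> and for the ring \<open>T\<close> of differential operators.
\<close>

type_synonym 'v mpoly = "('v \<Rightarrow>\<^sub>0 nat) \<Rightarrow>\<^sub>0 complex"

definition Var :: "'v \<Rightarrow> 'v mpoly" where
  "Var v = Poly_Mapping.single (Poly_Mapping.single v 1) 1"

definition smult :: "complex \<Rightarrow> 'v mpoly \<Rightarrow> 'v mpoly" where
  "smult c p = Poly_Mapping.single 0 c * p"

lemma vector_space_smult: "vector_space (smult :: complex \<Rightarrow> 'v mpoly \<Rightarrow> 'v mpoly)"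
proof
  fix a b :: complex and x y :: "'v mpoly"
  show "smult a (x + y) = smult a x + smult a y"
    by (simp add: smult_def algebra_simps)
  show "smult (a + b) x = smult a x + smult b x"
    by (simp add: smult_def single_add algebra_simps)
  show "smult a (smult b x) = smult (a * b) x"
    by (simp add: smult_def mult_single flip: mult.assoc)
  show "smult 1 x = x"
    by (simp add: smult_def)
qed

definition mdeg :: "('v::finite \<Rightarrow>\<^sub>0 nat) \<Rightarrow> nat" where
  "mdeg m = (\<Sum>v\<in>UNIV. Poly_Mapping.lookup m v)"

definition forms :: "nat \<Rightarrow> 'v::finite mpoly set" where
  "forms d = {p. \<forall>m\<in>Poly_Mapping.keys p. mdeg m = d}"

definition hom_component :: "nat \<Rightarrow> 'v::finite mpoly \<Rightarrow> 'v mpoly" where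
  "hom_component d p =
     (\<Sum>m | m \<in> Poly_Mapping.keys p \<and> mdeg m = d.
        Poly_Mapping.single m (Poly_Mapping.lookup p m))"


subsection \<open>The action of \<open>T\<close> on \<open>S\<close> by differentiation\<close>

definition pdiff :: "'v \<Rightarrow> 'v mpoly \<Rightarrow> 'v mpoly" where
  "pdiff v p =
     (\<Sum>m\<in>Poly_Mapping.keys p.
        Poly_Mapping.single (m - Poly_Mapping.single v 1)
          (of_nat (Poly_Mapping.lookup m v) * Poly_Mapping.lookup p m))"

lemma lookup_pdiff:
  "Poly_Mapping.lookup (pdiff v p) m =
     of_nat (Poly_Mapping.lookup m v + 1)
       * Poly_Mapping.lookup p (m + Poly_Mapping.single v 1)"
proof -
  let ?e = "Poly_Mapping.single v (1::nat)"
  have *: "k - ?e = m \<longleftrightarrow> k = m + ?e" if "Poly_Mapping.lookup k v \<noteq> 0"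
    for k :: "'a \<Rightarrow>\<^sub>0 nat"
  proof
    assume "k - ?e = m"
    then show "k = m + ?e"
      using that by (intro poly_mapping_eqI)
        (auto simp: lookup_add lookup_minus lookup_single when_def)
  qed auto
  have "Poly_Mapping.lookup (pdiff v p) m =
      (\<Sum>k\<in>Poly_Mapping.keys p.
         if k = m + ?e then of_nat (Poly_Mapping.lookup k v) * Poly_Mapping.lookup p k else 0)"
    unfolding pdiff_def lookup_sum
  proof (intro sum.cong refl)
    fix k
    show "Poly_Mapping.lookup (Poly_Mapping.single (k - ?e)
            (of_nat (Poly_Mapping.lookup k v) * Poly_Mapping.lookup p k)) m =
        (if k = m + ?e then of_nat (Poly_Mapping.lookup k v) * Poly_Mapping.lookup p k else 0)"
      using *[of k] by (cases "Poly_Mapping.lookup k v = 0") (auto simp: lookup_single when_def)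
  qed
  also have "\<dots> = of_nat (Poly_Mapping.lookup (m + ?e) v) * Poly_Mapping.lookup p (m + ?e)"
    by (auto simp: sum.delta in_keys_iff)
  finally show ?thesis
    by (simp add: lookup_add)
qed

lemma pdiff_commute: "pdiff v (pdiff w p) = pdiff w (pdiff v p)"
proof (rule poly_mapping_eqI)
  fix m
  show "Poly_Mapping.lookup (pdiff v (pdiff w p)) m = Poly_Mapping.lookup (pdiff w (pdiff v p)) m"
    by (cases "v = w") (simp_all add: lookup_pdiff lookup_add lookup_single add_ac)
qed

lemma comp_fun_commute_pdiff_power: "comp_fun_commute (\<lambda>v. pdiff v ^^ e v)"
proof -
  have 1: "(pdiff v ^^ k) (pdiff w p) = pdiff w ((pdiff v ^^ k) p)"
    for v w :: 'v and k and p :: "'v mpoly"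
    by (induction k) (simp_all add: pdiff_commute[of v w])
  have 2: "(pdiff v ^^ k) ((pdiff w ^^ l) p) = (pdiff w ^^ l) ((pdiff v ^^ k) p)"
    for v w :: 'v and k l and p :: "'v mpoly"
    by (induction l) (simp_all add: 1)
  show ?thesis
    by standard (simp add: fun_eq_iff 2)
qed

text \<open>
  A monomial acts as the composition of the corresponding powers of the partial derivatives.
  The order in which the fold visits the variables is irrelevant by the preceding lemma.
\<close>

definition mono_action :: "('v::finite \<Rightarrow>\<^sub>0 nat) \<Rightarrow> 'v mpoly \<Rightarrow> 'v mpoly" where
  "mono_action m p = Finite_Set.fold (\<lambda>v. pdiff v ^^ Poly_Mapping.lookup m v) p UNIV"

definition action :: "'v::finite mpoly \<Rightarrow> 'v mpoly \<Rightarrow> 'v mpoly"  (infixr \<open>\<circ>\<^sub>D\<close> 75) where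
  "g \<circ>\<^sub>D p = (\<Sum>m\<in>Poly_Mapping.keys g. smult (Poly_Mapping.lookup g m) (mono_action m p))"

definition perp :: "'v::finite mpoly \<Rightarrow> 'v mpoly set" where
  "perp F = {g. g \<circ>\<^sub>D F = 0}"


subsection \<open>Zero-dimensional closed subschemes of projective space\<close>

text \<open>
  The library has no schemes. A closed subscheme of projective space is represented by its
  saturated homogeneous ideal. Ideals of \<open>T\<close> are the submodules of \<open>T\<close> over itself.
\<close>

definition homogeneous_ideal :: "'v::finite mpoly set \<Rightarrow> bool" where
  "homogeneous_ideal I \<longleftrightarrow>
     module.subspace (*) I \<and> (\<forall>f\<in>I. \<forall>d. hom_component d f \<in> I)"

definition saturated :: "'v::finite mpoly set \<Rightarrow> bool" where
  "saturated I \<longleftrightarrow> (\<forall>f. (\<exists>k. \<forall>g\<in>forms k. g * f \<in> I) \<longrightarrow> f \<in> I)"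

text \<open>
  The points of the scheme \<open>Proj (T / I)\<close>: the homogeneous prime ideals of \<open>T\<close> that contain
  \<open>I\<close> but not the irrelevant ideal (which makes them proper).
\<close>

definition proj_points :: "'v::finite mpoly set \<Rightarrow> 'v mpoly set set" where
  "proj_points I =
     {P. homogeneous_ideal P \<and> (\<forall>f g. f * g \<in> P \<longrightarrow> f \<in> P \<or> g \<in> P) \<and>
         (\<exists>v. Var v \<notin> P) \<and> I \<subseteq> P}"

text \<open>
  Irreducible closed subsets of \<open>Proj (T / I)\<close> are the closures of its points, and inclusion of
  closures is reversed inclusion of primes. So the Krull dimension is zero iff there is a point
  and there are no strict inclusions between points.
\<close>

definition zero_dimensional :: "'v::finite mpoly set \<Rightarrow> bool" where
  "zero_dimensional I \<longleftrightarrow>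
     proj_points I \<noteq> {} \<and> (\<forall>P\<in>proj_points I. \<forall>Q\<in>proj_points I. P \<subseteq> Q \<longrightarrow> P = Q)"

text \<open>The Hilbert function of \<open>T / I\<close>, as the codimension of \<open>I\<^sub>d\<close> in the
  finite-dimensional space \<open>T\<^sub>d\<close>.\<close>

definition hilbert_function :: "'v::finite mpoly set \<Rightarrow> nat \<Rightarrow> nat" where
  "hilbert_function I d =
     vector_space.dim smult (forms d :: 'v mpoly set) - vector_space.dim smult (I \<inter> forms d)"

text \<open>The length of a zero-dimensional subscheme is its (constant) Hilbert polynomial.\<close>

definition has_length :: "'v::finite mpoly set \<Rightarrow> nat \<Rightarrow> bool" where
  "has_length I r \<longleftrightarrow> (\<forall>\<^sub>F d in sequentially. hilbert_function I d = r)"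


subsection \<open>Ranks\<close>

text \<open>
  Minima are taken in the extended naturals, so that the minimum over an empty set is \<open>\<infinity>\<close> rather
  than an unspecified number.
\<close>

definition cactus_rank :: "'v::finite mpoly \<Rightarrow> enat" where
  "cactus_rank F =
     Inf {enat r | r I. homogeneous_ideal I \<and> saturated I \<and> zero_dimensional I \<and>
                        has_length I r \<and> I \<subseteq> perp F}"

text \<open>The degree is an explicit argument because the zero form has every degree.\<close>

definition waring_rank :: "nat \<Rightarrow> 'v::finite mpoly \<Rightarrow> enat" where
  "waring_rank d G =
     Inf {enat r | r. \<exists>(\<alpha> :: nat \<Rightarrow> complex) (L :: nat \<Rightarrow> 'v mpoly).
                        (\<forall>i<r. L i \<in> forms 1) \<and> G = (\<Sum>i<r. smult (\<alpha> i) (L i ^ d))}"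

text \<open>Convergence in the finite-dimensional space of forms of degree \<open>d\<close> is convergence of all
  coefficients.\<close>

definition border_rank :: "nat \<Rightarrow> 'v::finite mpoly \<Rightarrow> enat" where
  "border_rank d F =
     Inf {enat r | r. \<exists>G :: nat \<Rightarrow> 'v mpoly.
                        (\<forall>k. G k \<in> forms d \<and> waring_rank d (G k) = enat r) \<and>
                        (\<forall>m. (\<lambda>k. Poly_Mapping.lookup (G k) m)
                               \<longlonglongrightarrow> Poly_Mapping.lookup F m)}"

end

theory Submission
  imports "HOL-Computational_Algebra.Polynomial" Defs
begin

text \<open>
  Write \<open>q = y\<^sub>1^2 + \<dots> + y\<^sub>n^2\<close>, so that \<open>F = x^2 q\<close>, and let \<open>y\<^sub>0\<close> be any of the variables \<open>y\<^sub>j\<close>.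

  Both lower bounds come from one catalecticant matrix. Differentiating \<open>F\<close> by the \<open>n + 2\<close> monomials
  \<open>x^2\<close>, \<open>x y\<^sub>j\<close>, \<open>y\<^sub>0^2\<close> and reading off the coefficients of \<open>y\<^sub>0^2\<close>, \<open>x y\<^sub>j\<close>, \<open>x^2\<close> gives, after weighting
  by factorials, \<open>4\<close> times an identity matrix (\<open>coef_sphere_form_row_col\<close>). Hence the \<open>n + 2\<close> monomials
  are independent modulo every ideal inside \<open>F\<^sup>\<bottom>\<close> (\<open>hilbert_function_2_ge\<close>). For a form of Waring rank
  \<open>r\<close> the same matrix is a sum of \<open>r\<close> matrices of rank one, so for \<open>r < n + 2\<close> it is singular; matrices
  close to a multiple of the identity are not singular, so forms close to \<open>F\<close> have Waring rank at
  least \<open>n + 2\<close> (\<open>eventually_waring_rank_ge\<close>).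

  For the cactus rank the Hilbert function in degree 2 has to be compared with the length, its
  eventual value. It can only grow along multiplication by a linear form that is a nonzerodivisor
  modulo the ideal. The usual source of such a form is prime avoidance for the associated primes.
  A more elementary argument is used here (\<open>exists_regular_linear_form\<close>). Consider the linear forms on
  a moment curve and, for each form \<open>f\<close> outside \<open>I\<close>, the set of those that multiply \<open>f\<close> into \<open>I\<close>.
  These sets are finite since \<open>I\<close> is saturated, and their maximal members play the part of the
  associated primes: forms of a common degree with distinct maximal sets are independent modulo \<open>I\<close>, so a bounded
  Hilbert function leaves only finitely many of them, and they cannot cover the whole curve.

  For the upper bounds, put \<open>x = 1\<close>, which turns \<open>F\<close> into \<open>q\<close>. The polynomials annihilating \<open>q\<close> define a scheme
  supported at the point \<open>(1 : 0 : \<dots> : 0)\<close>, whose local algebra has the basis \<open>1\<close>, \<open>y\<^sub>1, \<dots>, y\<^sub>n\<close>, \<open>y\<^sub>0^2\<close>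
  and therefore length \<open>n + 2\<close>; its ideal is contained in \<open>F\<^sup>\<bottom>\<close> (\<open>has_length_local_ideal\<close>,
  \<open>local_ideal_subset_perp\<close>). This scheme is a limit of \<open>n + 2\<close> points: with \<open>Y = y\<^sub>1 + \<dots> + y\<^sub>n\<close>,
  \<open>6 e^2 F = \<Sum>\<^sub>j (x + e y\<^sub>j)^4 + e\<^sup>-\<^sup>1 (x - e^2 Y)^4 - (n + e\<^sup>-\<^sup>1) x^4 + O(e^3)\<close>,
  because the terms in \<open>x^4\<close> and in \<open>x^3\<close> cancel (\<open>coef_approx\<close>).
\<close>

abbreviation coef :: "'v mpoly \<Rightarrow> ('v \<Rightarrow>\<^sub>0 nat) \<Rightarrow> complex" where
  "coef \<equiv> Poly_Mapping.lookup"

abbreviation expo :: "('v \<Rightarrow>\<^sub>0 nat) \<Rightarrow> 'v \<Rightarrow> nat" where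
  "expo \<equiv> Poly_Mapping.lookup"

abbreviation mterm :: "('v \<Rightarrow>\<^sub>0 nat) \<Rightarrow> complex \<Rightarrow> 'v mpoly" where
  "mterm \<equiv> Poly_Mapping.single"

abbreviation pow :: "'v \<Rightarrow> nat \<Rightarrow> ('v \<Rightarrow>\<^sub>0 nat)" where
  "pow \<equiv> Poly_Mapping.single"

abbreviation ideal :: "'v mpoly set \<Rightarrow> bool" where
  "ideal \<equiv> module.subspace (*)"

interpretation vs: vector_space "smult :: complex \<Rightarrow> 'v mpoly \<Rightarrow> 'v mpoly"
  by (rule vector_space_smult)

section \<open>Coefficients, monomials and ideals\<close>

lemma coef_term_mult: "coef (mterm m c * p) (m + k) = c * coef p k"
  by (simp add: lookup_mult lookup_single when_mult)

lemma coef_term_mult_eq_0: "(\<And>l. k \<noteq> m + l) \<Longrightarrow> coef (mterm m c * p) k = 0"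
  by (simp add: lookup_mult lookup_single when_mult)

lemma coef_smult [simp]: "coef (smult c p) m = c * coef p m"
  using coef_term_mult[of 0 c p m] by (simp add: smult_def)

lemma smult_term [simp]: "smult c (mterm m a) = mterm m (c * a)"
  by (simp add: smult_def mult_single)

lemma smult_mult: "smult c p * q = smult c (p * q)" "p * smult c q = smult c (p * q)"
  by (simp_all add: smult_def ac_simps)

lemma mpoly_sum_terms: "p = (\<Sum>m\<in>Poly_Mapping.keys p. mterm m (coef p m))"
proof (rule poly_mapping_eqI)
  fix k
  have "(\<Sum>m\<in>Poly_Mapping.keys p. coef (mterm m (coef p m)) k)
      = (\<Sum>m\<in>Poly_Mapping.keys p. if m = k then coef p k else 0)"
    by (intro sum.cong) (auto simp: lookup_single when_def)
  then show "coef p k = coef (\<Sum>m\<in>Poly_Mapping.keys p. mterm m (coef p m)) k"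
    by (simp add: lookup_sum in_keys_iff)
qed

lemma module_mult_mpoly: "module ((*) :: 'v mpoly \<Rightarrow> 'v mpoly \<Rightarrow> 'v mpoly)"
  by standard (simp_all add: algebra_simps)

lemma ideal_iff:
  "ideal I \<longleftrightarrow> 0 \<in> I \<and> (\<forall>f\<in>I. \<forall>g\<in>I. f + g \<in> I) \<and> (\<forall>h. \<forall>f\<in>I. h * f \<in> I)"
  by (auto simp: module.subspace_def[OF module_mult_mpoly])

lemma ideal_mult: "ideal I \<Longrightarrow> f \<in> I \<Longrightarrow> h * f \<in> I"
  by (simp add: ideal_iff)

lemma ideal_subspace: "ideal I \<Longrightarrow> vs.subspace I"
  by (auto simp: vs.subspace_def ideal_iff smult_def)

text \<open>Monomials span the polynomial ring over the constants.\<close>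
lemma ideal_if_closed_under_terms:
  assumes "vs.subspace I" and "\<And>m f. f \<in> I \<Longrightarrow> mterm m 1 * f \<in> I"
  shows "ideal I"
proof -
  have "h * f \<in> I" if "f \<in> I" for h f
  proof -
    have "h * f = (\<Sum>m\<in>Poly_Mapping.keys h. smult (coef h m) (mterm m 1 * f))"
      by (subst mpoly_sum_terms[of h]) (simp add: sum_distrib_right flip: smult_mult(1))
    also have "\<dots> \<in> I"
      using that by (intro vs.subspace_sum[OF assms(1)] vs.subspace_scale[OF assms(1)] assms(2))
    finally show ?thesis .
  qed
  then show ?thesis
    using assms(1) by (auto simp: ideal_iff vs.subspace_def)
qed

lemma mdeg_0 [simp]: "mdeg 0 = 0"
  by (simp add: mdeg_def)

lemma mdeg_add [simp]: "mdeg (m + k) = mdeg m + mdeg k"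
  by (simp add: mdeg_def lookup_add sum.distrib)

lemma mdeg_pow [simp]: "mdeg (pow v a) = a"
  by (simp add: mdeg_def lookup_single when_def)

lemma exponent_split: "expo m v \<noteq> 0 \<Longrightarrow> m = (m - pow v 1) + pow v 1"
  by (rule poly_mapping_eqI) (auto simp: lookup_add lookup_minus lookup_single when_def)

lemma forms_iff: "p \<in> forms d \<longleftrightarrow> (\<forall>m. coef p m \<noteq> 0 \<longrightarrow> mdeg m = d)"
  by (auto simp: forms_def in_keys_iff)

lemma subspace_forms: "vs.subspace (forms d)"
  unfolding vs.subspace_def by (auto simp: forms_iff lookup_add) (metis add.right_neutral)

lemma term_in_forms: "mdeg m = d \<Longrightarrow> mterm m c \<in> forms d"
  by (auto simp: forms_iff lookup_single when_def)

lemma Var_in_forms: "Var v \<in> forms 1"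
  by (simp add: Var_def term_in_forms)

lemma forms_mult:
  assumes "p \<in> forms d" "q \<in> forms e"
  shows "p * q \<in> forms (d + e)"
proof -
  have "p * q = (\<Sum>m\<in>Poly_Mapping.keys p. \<Sum>k\<in>Poly_Mapping.keys q. mterm (m + k) (coef p m * coef q k))"
    by (subst (1) mpoly_sum_terms[of p], subst (1) mpoly_sum_terms[of q])
       (simp add: sum_product mult_single)
  also have "\<dots> \<in> forms (d + e)"
    using assms by (intro vs.subspace_sum[OF subspace_forms] term_in_forms) (auto simp: forms_def)
  finally show ?thesis .
qed

lemma forms_power: "p \<in> forms d \<Longrightarrow> p ^ e \<in> forms (e * d)"
proof (induction e)
  case 0
  show ?case
    using term_in_forms[of 0 0 1] by simp
qed (simp add: forms_mult)

lemma forms_prod: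
  "finite A \<Longrightarrow> (\<And>a. a \<in> A \<Longrightarrow> p a \<in> forms 1) \<Longrightarrow> (\<Prod>a\<in>A. p a) \<in> forms (card A)"
proof (induction A rule: finite_induct)
  case empty
  show ?case
    using term_in_forms[of 0 0 1] by simp
next
  case (insert a A)
  then show ?case
    using forms_mult[of "p a" 1 "\<Prod>a\<in>A. p a" "card A"] by simp
qed

lemma finite_mdeg: "finite {m :: 'v::finite \<Rightarrow>\<^sub>0 nat. mdeg m = d}"
proof -
  have "expo m v \<le> d" if "mdeg m = d" for m :: "'v \<Rightarrow>\<^sub>0 nat" and v
    unfolding that[symmetric] mdeg_def by (rule member_le_sum) auto
  then have "expo ` {m. mdeg m = d} \<subseteq> {f :: 'v \<Rightarrow> nat. \<forall>v. (v \<in> UNIV \<longrightarrow> f v \<in> {..d}) \<and> (v \<notin> UNIV \<longrightarrow> f v = 0)}"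
    by auto
  then have "finite (expo ` {m :: 'v \<Rightarrow>\<^sub>0 nat. mdeg m = d})"
    by (rule finite_subset[OF _ finite_set_of_finite_funs[OF finite finite_atMost]])
  then show ?thesis
    by (rule finite_imageD) (simp add: inj_on_def lookup_inject)
qed

lemma forms_subset_span:
  "forms d \<subseteq> vs.span ((\<lambda>m. mterm m 1) ` {m :: 'v::finite \<Rightarrow>\<^sub>0 nat. mdeg m = d})"
proof
  fix p :: "'v mpoly"
  assume p: "p \<in> forms d"
  have "p = (\<Sum>m\<in>Poly_Mapping.keys p. smult (coef p m) (mterm m 1))"
    by (subst mpoly_sum_terms) simp
  also have "\<dots> \<in> vs.span ((\<lambda>m. mterm m 1) ` {m. mdeg m = d})"
    using p by (intro vs.span_sum vs.span_scale vs.span_base) (auto simp: forms_def)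
  finally show "p \<in> vs.span ((\<lambda>m. mterm m 1) ` {m. mdeg m = d})" .
qed

lemma coef_hom_component: "coef (hom_component d p) m = (if mdeg m = d then coef p m else 0)"
proof -
  have "coef (hom_component d p) m
      = (\<Sum>k | k \<in> Poly_Mapping.keys p \<and> mdeg k = d. if k = m then coef p m else 0)"
    unfolding hom_component_def lookup_sum
    by (intro sum.cong) (auto simp: lookup_single when_def)
  then show ?thesis
    by (auto simp: in_keys_iff)
qed

section \<open>Linear algebra modulo a subspace\<close>

definition independent_mod :: "'v mpoly set \<Rightarrow> ('i \<Rightarrow> 'v mpoly) \<Rightarrow> 'i set \<Rightarrow> bool" where
  "independent_mod U w A \<longleftrightarrow> (\<forall>c. (\<Sum>a\<in>A. smult (c a) (w a)) \<in> U \<longrightarrow> (\<forall>a\<in>A. c a = 0))"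

lemma independent_modD:
  "independent_mod U w A \<Longrightarrow> (\<Sum>a\<in>A. smult (c a) (w a)) \<in> U \<Longrightarrow> a \<in> A \<Longrightarrow> c a = 0"
  by (simp add: independent_mod_def)

text \<open>
  The Hilbert function is a difference of two dimensions. This lemma and the next replace it by
  what the arguments below use, the largest number of degree \<open>d\<close> forms independent modulo \<open>I\<close>.
  Here a family independent modulo \<open>I\<close> extends a basis of \<open>I\<^sub>d\<close> to an independent set.
\<close>
lemma card_independent_mod_le_hilbert_function:
  fixes w :: "'i \<Rightarrow> 'v::finite mpoly"
  assumes I: "vs.subspace I" and A: "finite A" and w: "\<And>a. a \<in> A \<Longrightarrow> w a \<in> forms d"
    and ind: "independent_mod I w A"
  shows "card A \<le> hilbert_function I d"
proof -
  obtain B where B: "B \<subseteq> I \<inter> forms d" "vs.independent B" "I \<inter> forms d \<subseteq> vs.span B"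
      "card B = vs.dim (I \<inter> forms d)"
    by (rule vs.basis_exists)
  obtain E :: "'v mpoly set" where E: "E \<subseteq> forms d" "vs.independent E" "forms d \<subseteq> vs.span E" "card E = vs.dim (forms d :: 'v mpoly set)"
    by (rule vs.basis_exists)
  have finE: "finite E"
    using vs.independent_span_bound[OF _ E(2), of "(\<lambda>m. mterm m 1) ` {m. mdeg m = d}"]
      E(1) forms_subset_span[of d] finite_mdeg[of d, where ?'v = 'v] by auto
  have finB: "finite B"
    using vs.independent_span_bound[OF finE B(2)] B(1) E(3) by auto
  have span_B: "vs.span B \<subseteq> I"
    using B(1) by (intro vs.span_minimal I) auto
  have single: "c = 0" if "a \<in> A" "smult c (w a) \<in> I" for a c
  proof -
    have "(\<Sum>b\<in>A. smult (if b = a then c else 0) (w b)) = (\<Sum>b\<in>A. if b = a then smult c (w a) else 0)"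
      by (intro sum.cong) auto
    then have "(\<Sum>b\<in>A. smult (if b = a then c else 0) (w b)) \<in> I"
      using that A by simp
    then show ?thesis
      using independent_modD[OF ind _ that(1)] by fastforce
  qed
  have inj: "inj_on w A"
  proof (rule inj_onI, rule ccontr)
    fix a b
    assume ab: "a \<in> A" "b \<in> A" "w a = w b" "a \<noteq> b"
    let ?c = "\<lambda>x. if x = a then 1 else if x = b then -1 else (0::complex)"
    have "(\<Sum>x\<in>A. smult (?c x) (w x)) = (\<Sum>x\<in>{a, b}. smult (?c x) (w x))"
      using ab A by (intro sum.mono_neutral_right) auto
    also have "\<dots> = 0"
      using ab by simp
    finally have "(\<Sum>x\<in>A. smult (?c x) (w x)) \<in> I"
      using vs.subspace_0[OF I] by simp
    then have "?c a = 0"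
      using ab(1) by (rule independent_modD[OF ind])
    then show False
      by simp
  qed
  have disj: "w ` A \<inter> B = {}"
    using single[of _ 1] B(1) by auto
  have "vs.independent (w ` A \<union> B)"
    unfolding vs.dependent_finite[OF finite_UnI[OF finite_imageI[OF A] finB]]
  proof (rule notI, elim exE conjE)
    fix u
    assume nz: "\<exists>v\<in>w ` A \<union> B. u v \<noteq> 0" and 0: "(\<Sum>v\<in>w ` A \<union> B. smult (u v) v) = 0"
    have split: "(\<Sum>a\<in>A. smult (u (w a)) (w a)) + (\<Sum>v\<in>B. smult (u v) v) = 0"
      using 0 A finB disj inj by (simp add: sum.union_disjoint sum.reindex)
    have "(\<Sum>v\<in>B. smult (u v) v) \<in> I"
      using span_B by (meson subsetD vs.span_base vs.span_scale vs.span_sum)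
    then have "(\<Sum>a\<in>A. smult (u (w a)) (w a)) \<in> I"
      unfolding add_eq_0_iff2[THEN iffD1, OF split] by (rule vs.subspace_neg[OF I])
    then have uA: "u (w a) = 0" if "a \<in> A" for a
      using that by (rule independent_modD[OF ind, of "\<lambda>a. u (w a)"])
    then have "(\<Sum>v\<in>B. smult (u v) v) = 0"
      using split by simp
    then have "u v = 0" if "v \<in> B" for v
      using that by (rule vs.independentD[OF B(2) finB subset_refl])
    then show False
      using nz uA by auto
  qed
  moreover have "w ` A \<union> B \<subseteq> vs.span E"
    using w B(1) E(3) by auto
  ultimately have "card (w ` A \<union> B) \<le> card E"
    using vs.independent_span_bound[OF finE] by blast
  moreover have "card (w ` A \<union> B) = card A + card B"
    using A finB disj inj by (simp add: card_Un_disjoint card_image)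
  ultimately show ?thesis
    using B(4) E(4) by (simp add: hilbert_function_def)
qed

text \<open>The vectors that extend a basis of \<open>I\<^sub>d\<close> to a basis of the space of all forms of degree \<open>d\<close>.\<close>
lemma hilbert_function_basis:
  fixes I :: "'v::finite mpoly set"
  assumes I: "vs.subspace I"
  obtains A where "finite A" "A \<subseteq> forms d" "card A = hilbert_function I d" "independent_mod I id A"
proof -
  obtain B where B: "B \<subseteq> I \<inter> forms d" "vs.independent B" "I \<inter> forms d \<subseteq> vs.span B"
      "card B = vs.dim (I \<inter> forms d)"
    by (rule vs.basis_exists)
  obtain E where E: "B \<subseteq> E" "E \<subseteq> forms d" "vs.independent E" "forms d \<subseteq> vs.span E"
    using vs.maximal_independent_subset_extend[of B "forms d"] B(1,2) by blast
  have finE: "finite E"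
    using vs.independent_span_bound[OF _ E(3), of "(\<lambda>m. mterm m 1) ` {m. mdeg m = d}"]
      E(2) forms_subset_span[of d] finite_mdeg[of d, where ?'v = 'v] by auto
  have finB: "finite B"
    using finE E(1) by (rule rev_finite_subset)
  have "card (E - B) = hilbert_function I d"
    using E(1) finB B(4) vs.basis_card_eq_dim[OF E(2,4,3)]
    by (simp add: card_Diff_subset hilbert_function_def)
  moreover have "independent_mod I id (E - B)"
    unfolding independent_mod_def
  proof (intro allI impI)
    fix c
    assume "(\<Sum>a\<in>E - B. smult (c a) (id a)) \<in> I"
    moreover have "(\<Sum>a\<in>E - B. smult (c a) (id a)) \<in> forms d"
      using E(2) by (intro vs.subspace_sum[OF subspace_forms] vs.subspace_scale[OF subspace_forms]) auto
    ultimately have "(\<Sum>a\<in>E - B. smult (c a) a) \<in> vs.span B"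
      using B(3) by auto
    then obtain e where e: "(\<Sum>a\<in>E - B. smult (c a) a) = (\<Sum>b\<in>B. smult (e b) b)"
      unfolding vs.span_finite[OF finB] by auto
    let ?u = "\<lambda>v. if v \<in> B then - e v else c v"
    have "(\<Sum>v\<in>E. smult (?u v) v) = (\<Sum>v\<in>E - B. smult (?u v) v) + (\<Sum>v\<in>B. smult (?u v) v)"
      by (rule sum.subset_diff[OF E(1) finE])
    also have "\<dots> = (\<Sum>v\<in>E - B. smult (c v) v) - (\<Sum>v\<in>B. smult (e v) v)"
      by (simp add: sum_negf vs.scale_minus_left)
    finally have "(\<Sum>v\<in>E. smult (?u v) v) = 0"
      using e by simp
    then have "?u v = 0" if "v \<in> E" for v
      by (rule vs.independentD[OF E(3) finE subset_refl _ that])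
    then show "\<forall>a\<in>E - B. c a = 0"
      by (metis DiffD1 DiffD2)
  qed
  ultimately show ?thesis
    using that[of "E - B"] finE E(2) by auto
qed

lemma hilbert_function_le_Suc:
  fixes I :: "'v::finite mpoly set"
  assumes I: "vs.subspace I" and l: "l \<in> forms 1"
    and regular: "\<And>f. f \<in> forms d \<Longrightarrow> l * f \<in> I \<Longrightarrow> f \<in> I"
  shows "hilbert_function I d \<le> hilbert_function I (Suc d)"
proof -
  obtain A where A: "finite A" "A \<subseteq> forms d" "card A = hilbert_function I d" "independent_mod I id A"
    by (rule hilbert_function_basis[OF I])
  have "independent_mod I (\<lambda>a. l * a) A"
    unfolding independent_mod_def
  proof (intro allI impI)
    fix c
    assume "(\<Sum>a\<in>A. smult (c a) (l * a)) \<in> I"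
    then have "l * (\<Sum>a\<in>A. smult (c a) a) \<in> I"
      by (simp add: sum_distrib_left smult_mult)
    moreover have "(\<Sum>a\<in>A. smult (c a) a) \<in> forms d"
      using A(2) by (intro vs.subspace_sum[OF subspace_forms] vs.subspace_scale[OF subspace_forms]) auto
    ultimately show "\<forall>a\<in>A. c a = 0"
      using regular A(4) by (auto simp: independent_mod_def)
  qed
  then have "card A \<le> hilbert_function I (Suc d)"
    using A(1,2) forms_mult[OF l] by (intro card_independent_mod_le_hilbert_function[OF I]) auto
  then show ?thesis
    by (simp add: A(3))
qed

text \<open>Gaussian elimination: an equation with a nonzero coefficient eliminates one unknown.\<close>
lemma more_unknowns_than_equations:
  fixes M :: "'i \<Rightarrow> 'j \<Rightarrow> 'a::field"
  assumes "finite B" "finite A" "card B < card A"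
  shows "\<exists>c. (\<exists>a\<in>A. c a \<noteq> 0) \<and> (\<forall>b\<in>B. (\<Sum>a\<in>A. c a * M a b) = 0)"
  using assms
proof (induction B arbitrary: A M rule: finite_induct)
  case empty
  then have "A \<noteq> {}"
    by auto
  then show ?case
    by (intro exI[of _ "\<lambda>_. 1"]) auto
next
  case (insert b B)
  show ?case
  proof (cases "\<forall>a\<in>A. M a b = 0")
    case True
    then show ?thesis
      using insert.IH[of A M] insert.prems insert.hyps by auto
  next
    case False
    then obtain p where p: "p \<in> A" "M p b \<noteq> 0"
      by auto
    obtain c where c: "\<exists>a\<in>A - {p}. c a \<noteq> 0"
        "\<forall>b'\<in>B. (\<Sum>a\<in>A - {p}. c a * (M a b' - M a b / M p b * M p b')) = 0"
    proof -
      have "card B < card (A - {p})"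
        using insert.prems insert.hyps p by simp
      then show ?thesis
        using insert.IH[of "A - {p}" "\<lambda>a b'. M a b' - M a b / M p b * M p b'"] insert.prems(1) that
        by blast
    qed
    define s where "s = (\<Sum>a\<in>A - {p}. c a * M a b) / M p b"
    have split: "(\<Sum>a\<in>A. (c(p := - s)) a * M a b') = (\<Sum>a\<in>A - {p}. c a * M a b') - s * M p b'" for b'
    proof -
      have "(\<Sum>a\<in>A. (c(p := - s)) a * M a b')
          = (c(p := - s)) p * M p b' + (\<Sum>a\<in>A - {p}. (c(p := - s)) a * M a b')"
        by (rule sum.remove[OF insert.prems(1) p(1)])
      also have "(\<Sum>a\<in>A - {p}. (c(p := - s)) a * M a b') = (\<Sum>a\<in>A - {p}. c a * M a b')"
        by (rule sum.cong) auto
      finally show ?thesis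
        by simp
    qed
    have "(\<Sum>a\<in>A - {p}. c a * M a b') - s * M p b' = 0" if "b' \<in> B" for b'
      using c(2) that
      by (simp add: s_def right_diff_distrib sum_subtractf sum_distrib_right sum_divide_distrib mult.assoc)
    moreover have "(\<Sum>a\<in>A - {p}. c a * M a b) - s * M p b = 0"
      using p by (simp add: s_def)
    ultimately have "\<forall>b'\<in>insert b B. (\<Sum>a\<in>A. (c(p := - s)) a * M a b') = 0"
      unfolding split by auto
    moreover have "\<exists>a\<in>A. (c(p := - s)) a \<noteq> 0"
      using c(1) by auto
    ultimately show ?thesis
      by blast
  qed
qed

section \<open>A linear form that is regular modulo a saturated ideal\<close>

lemma mdeg_eq_1D:
  assumes "mdeg (m :: 'v::finite \<Rightarrow>\<^sub>0 nat) = 1"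
  obtains v where "m = pow v 1"
proof -
  have "\<exists>v\<in>UNIV. expo m v = 1 \<and> (\<forall>w\<in>UNIV. v \<noteq> w \<longrightarrow> expo m w = 0)"
    using assms unfolding mdeg_def by (subst (asm) sum_eq_1_iff) auto
  then obtain v where "expo m v = 1" "\<And>w. v \<noteq> w \<Longrightarrow> expo m w = 0"
    by auto
  then have "m = pow v 1"
    by (intro poly_mapping_eqI) (auto simp: lookup_single when_def)
  then show ?thesis
    by (rule that)
qed

text \<open>
  The Vandermonde argument for polynomials with vector coefficients. Dividing by \<open>X - s\<close> lowers the
  degree, and the values of the quotient at the other points are divided differences of values of
  \<open>p\<close>, so they stay in the subspace.
\<close>
lemma coeffs_in_subspace_if_many_values:
  fixes p :: "'v mpoly poly"
  assumes W: "vs.subspace W" and "finite S" and "degree p < card S"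
    and "\<And>s. s \<in> S \<Longrightarrow> poly p (smult s 1) \<in> W"
  shows "coeff p k \<in> W"
  using assms(2-)
proof (induction S arbitrary: p k rule: finite_induct)
  case empty
  then show ?case
    by simp
next
  case (insert s S)
  have val: "poly p (smult s 1) \<in> W"
    using insert.prems by simp
  show ?case
  proof (cases "degree p = 0")
    case True
    then obtain a where "p = [:a:]"
      by (rule degree_eq_zeroE)
    then show ?thesis
      using val vs.subspace_0[OF W] by (simp add: coeff_pCons split: nat.split)
  next
    case False
    define q where "q = synthetic_div p (smult s 1)"
    have q: "coeff q j \<in> W" for j
    proof (rule insert.IH)
      show "degree q < card S"
        using False insert.prems(1) insert.hyps by (simp add: q_def degree_synthetic_div)
      fix u
      assume u: "u \<in> S"
      have "poly p (smult u 1) = poly ([:- smult s 1, 1:] * q + [:poly p (smult s 1):]) (smult u 1)"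
        by (simp only: q_def synthetic_div_correct')
      also have "\<dots> = smult (u - s) (poly q (smult u 1)) + poly p (smult s 1)"
        by (simp add: vs.scale_left_diff_distrib smult_mult left_diff_distrib)
      finally have "smult (u - s) (poly q (smult u 1)) = poly p (smult u 1) - poly p (smult s 1)"
        by simp
      then have "smult (u - s) (poly q (smult u 1)) \<in> W"
        using val insert.prems(2)[of u] u vs.subspace_diff[OF W] by simp
      then have "smult (inverse (u - s)) (smult (u - s) (poly q (smult u 1))) \<in> W"
        by (rule vs.subspace_scale[OF W])
      moreover have "inverse (u - s) * (u - s) = 1"
        using u insert.hyps by (intro left_inverse) auto
      ultimately show "poly q (smult u 1) \<in> W"
        by simp
    qed
    have "p = pCons (poly p (smult s 1)) q - Polynomial.smult (smult s 1) q"
      using synthetic_div_correct[of p "smult s 1"] by (simp add: q_def eq_diff_eq)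
    then have "coeff p k = coeff (pCons (poly p (smult s 1)) q - Polynomial.smult (smult s 1) q) k"
      by (rule arg_cong)
    then have "coeff p k = coeff (pCons (poly p (smult s 1)) q) k - smult s (coeff q k)"
      by (simp only: coeff_diff Polynomial.coeff_smult smult_mult mult_1)
    moreover have "coeff (pCons (poly p (smult s 1)) q) k \<in> W"
      using val q by (simp add: coeff_pCons split: nat.split)
    ultimately show ?thesis
      using q vs.subspace_diff[OF W] vs.subspace_scale[OF W] by simp
  qed
qed

lemma saturated_if_killed_by_Vars:
  assumes I: "ideal I" "saturated I" and f: "\<And>v. Var v * f \<in> I"
  shows "f \<in> I"
proof -
  have "g * f \<in> I" if "g \<in> forms 1" for g
  proof -
    have "mterm m c * f \<in> I" if m: "mdeg m = 1" for m c
    proof -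
      obtain v where "m = pow v 1"
        using mdeg_eq_1D[OF m] by blast
      then have "mterm m c * f = smult c (Var v * f)"
        by (simp add: Var_def flip: smult_mult(1))
      then show ?thesis
        using f vs.subspace_scale[OF ideal_subspace[OF I(1)]] by simp
    qed
    then have "(\<Sum>m\<in>Poly_Mapping.keys g. mterm m (coef g m) * f) \<in> I"
      using that by (intro vs.subspace_sum[OF ideal_subspace[OF I(1)]]) (auto simp: forms_def)
    then show ?thesis
      by (subst mpoly_sum_terms) (simp add: sum_distrib_right)
  qed
  then show ?thesis
    using I(2) unfolding saturated_def by blast
qed

text \<open>
  The linear forms at the integer points of a moment curve; \<open>e\<close> numbers the variables. As many of
  them as there are variables always span the space of linear forms.
\<close>
definition moment_form :: "('v \<Rightarrow> nat) \<Rightarrow> nat \<Rightarrow> 'v::finite mpoly" where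
  "moment_form e t = (\<Sum>v\<in>UNIV. smult (of_nat t ^ e v) (Var v))"

lemma moment_form_in_forms: "moment_form e t \<in> forms 1"
  unfolding moment_form_def
  by (intro vs.subspace_sum[OF subspace_forms] vs.subspace_scale[OF subspace_forms] Var_in_forms)

text \<open>
  If the set had more elements than there are variables, every variable would multiply \<open>f\<close> into
  \<open>I\<close>, and saturation would put \<open>f\<close> into \<open>I\<close>.
\<close>
lemma few_moment_forms_kill:
  fixes f :: "'v::finite mpoly"
  assumes I: "ideal I" "saturated I" and e: "bij_betw e (UNIV :: 'v set) {0..<CARD('v)}" and f: "f \<notin> I"
  shows "finite {t. moment_form e t * f \<in> I} \<and> card {t. moment_form e t * f \<in> I} \<le> CARD('v)"
proof (rule ccontr)
  assume many: "\<not> ?thesis"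
  obtain S where S: "S \<subseteq> {t. moment_form e t * f \<in> I}" "finite S" "card S = CARD('v)"
  proof (cases "finite {t. moment_form e t * f \<in> I}")
    case True
    then show ?thesis
      using many that by (meson nat_le_linear obtain_subset_with_card_n)
  next
    case False
    then show ?thesis
      using that by (meson infinite_arbitrarily_large)
  qed
  define p where "p = (\<Sum>v\<in>UNIV. monom (Var v * f) (e v))"
  have coeff_p: "coeff p k = (\<Sum>v\<in>UNIV. if e v = k then Var v * f else 0)" for k
    by (simp add: p_def coeff_sum)
  have inj: "inj e" and less: "e v < CARD('v)" for v
    using e by (auto simp: bij_betw_def)
  have smult_power: "smult s 1 ^ k = smult (s ^ k) 1" for s k
    by (induction k) (simp_all add: smult_mult)
  have "coeff p k \<in> I" for k
  proof (rule coeffs_in_subspace_if_many_values[OF ideal_subspace[OF I(1)]])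
    show "finite (of_nat ` S :: complex set)"
      using S(2) by simp
    have "degree p \<le> CARD('v) - 1"
    proof (rule degree_le, intro allI impI)
      fix i
      assume "CARD('v) - 1 < i"
      then have "e v \<noteq> i" for v
        using less[of v] by auto
      then show "coeff p i = 0"
        by (simp add: coeff_p)
    qed
    moreover have "0 < CARD('v)"
      by simp
    ultimately have "degree p < CARD('v)"
      by linarith
    then show "degree p < card (of_nat ` S :: complex set)"
      using S(3) by (simp add: card_image inj_on_def)
    fix s :: complex
    assume "s \<in> of_nat ` S"
    then obtain t where t: "s = of_nat t" "t \<in> S"
      by auto
    have "poly p (smult s 1) = moment_form e t * f"
      by (simp add: p_def poly_sum poly_monom smult_power t moment_form_def sum_distrib_right smult_mult)
    then show "poly p (smult s 1) \<in> I"
      using t S(1) by auto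
  qed
  moreover have "coeff p (e v) = Var v * f" for v
  proof -
    have "coeff p (e v) = (\<Sum>w\<in>UNIV. if w = v then Var v * f else 0)"
      unfolding coeff_p using inj by (intro sum.cong) (auto dest: injD)
    then show ?thesis
      by simp
  qed
  ultimately have "f \<in> I"
    by (metis saturated_if_killed_by_Vars[OF I])
  then show False
    using f by simp
qed

text \<open>
  Prime avoidance without primes. If every form of the moment curve were a zero divisor, the maximal
  sets \<open>Z f\<close> would be finite and cover \<open>\<nat>\<close>, so there would be more than \<open>r\<close> of them. Representatives
  in a common large degree satisfy a linear relation modulo \<open>I\<close>. Multiplying by one linear form from
  each of the other sets isolates a single representative, and that product cannot lie in \<open>I\<close>
  because by maximality no multiple outside \<open>I\<close> has a larger set.
\<close>
lemma exists_regular_linear_form: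
  fixes I :: "'v::finite mpoly set"
  assumes I: "ideal I" "saturated I" and bounded: "\<And>d. D \<le> d \<Longrightarrow> hilbert_function I d \<le> r"
  obtains l where "l \<in> forms 1" "\<And>d f. f \<in> forms d \<Longrightarrow> l * f \<in> I \<Longrightarrow> f \<in> I"
proof (rule ccontr)
  assume "\<not> thesis"
  note sub = ideal_subspace[OF I(1)]
  obtain e where e: "bij_betw e (UNIV :: 'v set) {0..<CARD('v)}"
    using ex_bij_betw_finite_nat[of "UNIV :: 'v set"] by auto
  define l where "l t = (moment_form e t :: 'v mpoly)" for t
  have l: "l t \<in> forms 1" for t
    unfolding l_def by (rule moment_form_in_forms)
  define Z where "Z f = {t. l t * f \<in> I}" for f
  define H where "H = {f. f \<notin> I \<and> (\<exists>d. f \<in> forms d)}"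
  have Z_mult: "Z f \<subseteq> Z (g * f)" for f g
    using ideal_mult[OF I(1)] by (auto simp: Z_def mult.left_commute)
  have finite_Z: "finite (Z f)" and card_Z: "card (Z f) \<le> CARD('v)" if "f \<in> H" for f
    using few_moment_forms_kill[OF I e, of f] that by (auto simp: Z_def l_def H_def)
  have cover: "\<exists>f\<in>H. t \<in> Z f" for t
    using \<open>\<not> thesis\<close> that l[of t] by (auto simp: H_def Z_def)
  define \<M> where "\<M> = {Y. (\<exists>f\<in>H. Y = Z f) \<and> (\<forall>g\<in>H. Y \<subseteq> Z g \<longrightarrow> Z g = Y)}"
  have below_maximal: "\<exists>Y\<in>\<M>. Z f \<subseteq> Y" if f: "f \<in> H" for f
  proof -
    obtain g where g: "g \<in> H" "Z f \<subseteq> Z g"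
        "\<And>h. h \<in> H \<Longrightarrow> Z f \<subseteq> Z h \<Longrightarrow> card (Z h) \<le> card (Z g)"
      using ex_has_greatest_nat[of "\<lambda>g. g \<in> H \<and> Z f \<subseteq> Z g" f "\<lambda>g. card (Z g)" "Suc CARD('v)"] f card_Z
      by (auto simp: less_Suc_eq_le)
    have "Z h = Z g" if "h \<in> H" "Z g \<subseteq> Z h" for h
      using g that finite_Z[of h] by (metis card_seteq subset_trans)
    then have "Z g \<in> \<M>"
      using g(1) by (auto simp: \<M>_def)
    then show ?thesis
      using g(2) by auto
  qed
  have "infinite \<M>"
  proof
    assume "finite \<M>"
    then have "finite (\<Union>\<M>)"
      using finite_Z by (auto simp: \<M>_def)
    moreover have "\<Union>\<M> = UNIV"
      using cover below_maximal by blast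
    ultimately show False
      by simp
  qed
  then obtain B where B: "finite B" "card B = Suc r" "B \<subseteq> \<M>"
    by (meson infinite_arbitrarily_large)
  have "\<forall>Y\<in>B. \<exists>d f. f \<in> forms d \<and> f \<notin> I \<and> Z f = Y"
    using B(3) by (fastforce simp: \<M>_def H_def)
  then obtain deg where deg: "\<forall>Y\<in>B. \<exists>f. f \<in> forms (deg Y) \<and> f \<notin> I \<and> Z f = Y"
    by metis
  define d where "d = D + (\<Sum>Y\<in>B. deg Y)"
  \<comment> \<open>Saturation yields nonzero multiples in every higher degree, and maximality keeps their set.\<close>
  have "\<exists>h. h \<in> forms d \<and> h \<notin> I \<and> Z h = Y" if Y: "Y \<in> B" for Y
  proof -
    obtain f where f: "f \<in> forms (deg Y)" "f \<notin> I" "Z f = Y"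
      using deg Y by auto
    have le: "deg Y \<le> d"
      unfolding d_def using member_le_sum[OF Y _ B(1), of deg] by simp
    obtain g where g: "g \<in> forms (d - deg Y)" "g * f \<notin> I"
      using I(2) f(2) unfolding saturated_def by blast
    have "g * f \<in> forms d"
      using forms_mult[OF g(1) f(1)] le by simp
    moreover from this have "Z (g * f) = Y"
      using Y B(3) g(2) f(3) Z_mult[of f g] unfolding \<M>_def H_def by blast
    ultimately show ?thesis
      using g(2) by auto
  qed
  then obtain h where h: "\<And>Y. Y \<in> B \<Longrightarrow> h Y \<in> forms d" "\<And>Y. Y \<in> B \<Longrightarrow> h Y \<notin> I" "\<And>Y. Y \<in> B \<Longrightarrow> Z (h Y) = Y"
    by metis
  have "\<not> independent_mod I h B"
    using card_independent_mod_le_hilbert_function[OF sub B(1) h(1)] bounded[of d] B(2)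
    by (fastforce simp: d_def)
  then obtain c Y0 where c: "(\<Sum>Y\<in>B. smult (c Y) (h Y)) \<in> I" and Y0: "Y0 \<in> B" "c Y0 \<noteq> 0"
    by (auto simp: independent_mod_def)
  have "\<exists>t. t \<in> Y \<and> t \<notin> Y0" if "Y \<in> B - {Y0}" for Y
  proof (rule ccontr)
    assume "\<nexists>t. t \<in> Y \<and> t \<notin> Y0"
    then have "Y \<subseteq> Z (h Y0)"
      using h(3)[OF Y0(1)] by auto
    moreover have "h Y0 \<in> H"
      using h Y0 by (auto simp: H_def)
    ultimately have "Z (h Y0) = Y"
      using that B(3) by (auto simp: \<M>_def)
    then show False
      using h(3)[OF Y0(1)] that by auto
  qed
  then obtain s where s: "\<And>Y. Y \<in> B - {Y0} \<Longrightarrow> s Y \<in> Y" "\<And>Y. Y \<in> B - {Y0} \<Longrightarrow> s Y \<notin> Y0"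
    by metis
  \<comment> \<open>Since \<open>s Y \<notin> Y0\<close>, the factors can be multiplied in one at a time without reaching \<open>I\<close>.\<close>
  have not_in: "(\<Prod>Y\<in>A. l (s Y)) * h Y0 \<notin> I" if "finite A" "A \<subseteq> B - {Y0}" for A
    using that
  proof (induction A rule: finite_induct)
    case empty
    then show ?case
      using h(2)[OF Y0(1)] by simp
  next
    case (insert Y A)
    let ?f = "(\<Prod>Y\<in>A. l (s Y)) * h Y0"
    have "?f \<in> forms (card A + d)"
      using insert.hyps(1) l h(1)[OF Y0(1)] by (intro forms_mult forms_prod) auto
    moreover have "?f \<notin> I"
      using insert by auto
    moreover have "Y0 \<subseteq> Z ?f"
      using Z_mult h(3)[OF Y0(1)] by blast
    ultimately have "Z ?f = Y0"
      using Y0(1) B(3) unfolding \<M>_def H_def by blast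
    then have "l (s Y) * ?f \<notin> I"
      using s(2)[of Y] insert.prems by (auto simp: Z_def)
    then show ?case
      using insert.hyps by (simp add: mult.assoc)
  qed
  \<comment> \<open>The full product kills every term of the relation except the one at \<open>Y0\<close>.\<close>
  define P where "P = (\<Prod>Y\<in>B - {Y0}. l (s Y))"
  have "P * h Y \<in> I" if "Y \<in> B - {Y0}" for Y
  proof -
    have "P = (\<Prod>X\<in>B - {Y0} - {Y}. l (s X)) * l (s Y)"
      unfolding P_def using that B(1) by (simp add: prod.remove[of _ Y] mult.commute)
    moreover have "l (s Y) * h Y \<in> I"
      using s(1)[OF that] h(3)[of Y] that by (auto simp: Z_def)
    ultimately show ?thesis
      using ideal_mult[OF I(1)] by (simp add: mult.assoc)
  qed
  then have "(\<Sum>Y\<in>B - {Y0}. smult (c Y) (P * h Y)) \<in> I"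
    by (intro vs.subspace_sum[OF sub] vs.subspace_scale[OF sub])
  moreover have "P * (\<Sum>Y\<in>B. smult (c Y) (h Y)) \<in> I"
    using c by (rule ideal_mult[OF I(1)])
  then have "smult (c Y0) (P * h Y0) + (\<Sum>Y\<in>B - {Y0}. smult (c Y) (P * h Y)) \<in> I"
    using B(1) Y0(1) by (simp add: sum.remove[of B Y0] distrib_left sum_distrib_left smult_mult)
  ultimately have "smult (c Y0) (P * h Y0) \<in> I"
    using vs.subspace_diff[OF sub] by fastforce
  then have "smult (inverse (c Y0)) (smult (c Y0) (P * h Y0)) \<in> I"
    by (rule vs.subspace_scale[OF sub])
  then have "P * h Y0 \<in> I"
    using Y0(2) by simp
  then show False
    using not_in[of "B - {Y0}"] B(1) by (simp add: P_def)
qed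

section \<open>Apolarity\<close>

definition mfact :: "('v::finite \<Rightarrow>\<^sub>0 nat) \<Rightarrow> complex" where
  "mfact m = (\<Prod>v\<in>UNIV. fact (expo m v))"

text \<open>
  Coefficients with respect to divided powers. In them differentiation is a shift of exponents, and
  a power of a linear form becomes multiplicative in the exponent.
\<close>
definition dcoef :: "'v::finite mpoly \<Rightarrow> ('v \<Rightarrow>\<^sub>0 nat) \<Rightarrow> complex" where
  "dcoef p m = mfact m * coef p m"

lemma mfact_nonzero [simp]: "mfact m \<noteq> 0"
  by (simp add: mfact_def)

lemma mfact_add_pow: "mfact (m + pow v 1) = of_nat (expo m v + 1) * mfact m"
proof -
  have "mfact (m + pow v 1) = fact (expo m v + 1) * (\<Prod>w\<in>UNIV - {v}. fact (expo (m + pow v 1) w))"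
    unfolding mfact_def by (subst prod.remove[of UNIV v]) (simp_all add: lookup_add)
  also have "(\<Prod>w\<in>UNIV - {v}. fact (expo (m + pow v 1) w)) = (\<Prod>w\<in>UNIV - {v}. fact (expo m w) :: complex)"
    by (rule prod.cong) (auto simp: lookup_add lookup_single when_def)
  also have "fact (expo m v + 1) * \<dots>
      = of_nat (expo m v + 1) * (fact (expo m v) * (\<Prod>w\<in>UNIV - {v}. fact (expo m w)))"
    by (simp add: algebra_simps)
  also have "fact (expo m v) * (\<Prod>w\<in>UNIV - {v}. fact (expo m w)) = mfact m"
    unfolding mfact_def by (rule prod.remove[symmetric]) simp_all
  finally show ?thesis .
qed

lemma dcoef_pdiff: "dcoef (pdiff v p) m = dcoef p (m + pow v 1)"
  unfolding dcoef_def lookup_pdiff mfact_add_pow by (simp add: mult_ac)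

lemma dcoef_pdiff_power: "dcoef ((pdiff v ^^ j) p) m = dcoef p (m + pow v j)"
proof (induction j arbitrary: m)
  case (Suc j)
  have "pow v 1 + pow v j = pow v (Suc j)"
    by (simp flip: single_add)
  then show ?case
    by (simp add: dcoef_pdiff Suc.IH add.assoc del: One_nat_def)
qed simp

lemma dcoef_mono_action: "dcoef (mono_action m p) k = dcoef p (k + m)"
proof -
  interpret comp_fun_commute "\<lambda>v. pdiff v ^^ expo m v"
    by (rule comp_fun_commute_pdiff_power)
  have "dcoef (Finite_Set.fold (\<lambda>v. pdiff v ^^ expo m v) p A) k = dcoef p (k + (\<Sum>v\<in>A. pow v (expo m v)))"
    if "finite A" for A
    using that
  proof (induction A arbitrary: k rule: finite_induct)
    case (insert v A)
    then show ?case
      by (simp add: dcoef_pdiff_power add.assoc)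
  qed simp
  moreover have "(\<Sum>v\<in>UNIV. pow v (expo m v)) = m"
    by (rule poly_mapping_eqI) (simp add: lookup_sum lookup_single when_def)
  ultimately show ?thesis
    by (simp add: mono_action_def)
qed

lemma dcoef_action: "dcoef (g \<circ>\<^sub>D p) k = (\<Sum>m\<in>Poly_Mapping.keys g. coef g m * dcoef p (k + m))"
proof -
  have "dcoef (g \<circ>\<^sub>D p) k = (\<Sum>m\<in>Poly_Mapping.keys g. coef g m * dcoef (mono_action m p) k)"
    by (simp add: action_def dcoef_def lookup_sum sum_distrib_left mult.left_commute)
  then show ?thesis
    by (simp add: dcoef_mono_action)
qed

lemma perp_iff: "g \<in> perp p \<longleftrightarrow> (\<forall>k. (\<Sum>m\<in>Poly_Mapping.keys g. coef g m * dcoef p (k + m)) = 0)"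
proof -
  have "g \<in> perp p \<longleftrightarrow> (\<forall>k. dcoef (g \<circ>\<^sub>D p) k = 0)"
    by (auto simp: perp_def dcoef_def poly_mapping_eq_iff fun_eq_iff)
  then show ?thesis
    by (simp add: dcoef_action)
qed

section \<open>The form and its catalecticant matrix\<close>

lemma pow_eq_iff: "pow v i = pow v k \<longleftrightarrow> i = k"
  by (metis lookup_single_eq)

lemma sum_if_const: "(\<Sum>j\<in>A. if P then f j else 0) = (if P then \<Sum>j\<in>A. f j else 0)"
  by simp

lemma Var_power: "Var v ^ k = mterm (pow v k) 1"
  by (induction k) (simp_all add: Var_def mult_single flip: single_add)

text \<open>The exponent of \<open>x^c y\<^sub>j^e\<close>.\<close>
definition xyexp :: "nat \<Rightarrow> 'n \<Rightarrow> nat \<Rightarrow> ('n option \<Rightarrow>\<^sub>0 nat)" where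
  "xyexp c j e = pow None c + pow (Some j) e"

lemma expo_xyexp [simp]:
  "expo (xyexp c j e) None = c" "expo (xyexp c j e) (Some i) = (if i = j then e else 0)"
  by (simp_all add: xyexp_def lookup_add lookup_single when_def)

lemma mdeg_xyexp [simp]: "mdeg (xyexp c j e) = c + e"
  by (simp add: xyexp_def)

lemma xyexp_0: "xyexp c j 0 = pow None c"
  by (simp add: xyexp_def)

definition sphere_form :: "'n::finite option mpoly" where
  "sphere_form = Var None ^ 2 * (\<Sum>j\<in>UNIV. Var (Some j) ^ 2)"

lemma coef_sphere_form:
  fixes m :: "'n::finite option \<Rightarrow>\<^sub>0 nat"
  shows "coef sphere_form m = (\<Sum>j\<in>UNIV. if m = xyexp 2 j 2 then 1 else 0)"
proof -
  have eq: "(sphere_form :: 'n option mpoly) = (\<Sum>j\<in>UNIV. mterm (xyexp 2 j 2) 1)"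
    by (simp add: sphere_form_def Var_power sum_distrib_left mult_single xyexp_def)
  show ?thesis
    unfolding eq by (simp add: lookup_sum lookup_single when_def eq_commute[of m])
qed

lemma dcoef_sphere_form: "dcoef sphere_form m = 4 * coef sphere_form m"
proof -
  have "mfact (xyexp 2 j 2) = 4" for j :: 'a
  proof -
    have "xyexp 2 j 2 = 0 + pow None 1 + pow None 1 + pow (Some j) 1 + pow (Some j) 1"
      by (rule poly_mapping_eqI)
        (auto simp: xyexp_def lookup_add lookup_single when_def)
    moreover have "mfact (0 :: 'a option \<Rightarrow>\<^sub>0 nat) = 1"
      by (simp add: mfact_def)
    ultimately show ?thesis
      by (simp only: mfact_add_pow) (simp add: lookup_add lookup_single when_def)
  qed
  then have "mfact m = 4" if "coef sphere_form m \<noteq> 0"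
    using that by (auto simp: coef_sphere_form intro: ccontr elim!: sum.not_neutral_contains_not_neutral split: if_splits)
  then show ?thesis
    by (auto simp: dcoef_def)
qed

text \<open>
  The coefficient of \<open>g \<circ>\<^sub>D F\<close> at an exponent \<open>k\<close> pairs the product of \<open>g\<close> and the monomial \<open>k\<close>
  with \<open>F\<close>.
\<close>
lemma perp_sphere_form_iff:
  "g \<in> perp sphere_form \<longleftrightarrow> (\<forall>k. (\<Sum>j\<in>UNIV. coef (mterm k 1 * g) (xyexp 2 j 2)) = 0)"
proof -
  have pick: "(\<Sum>m\<in>Poly_Mapping.keys g. if k + m = s then coef g m else 0) = coef (mterm k 1 * g) s" for k s
  proof (cases "\<exists>l. s = k + l")
    case True
    then obtain l where "s = k + l"
      by auto
    then show ?thesis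
      by (simp add: coef_term_mult in_keys_iff)
  next
    case False
    then have "coef (mterm k 1 * g) s = 0"
      by (intro coef_term_mult_eq_0) auto
    with False show ?thesis
      by (auto intro!: sum.neutral)
  qed
  have "(\<Sum>m\<in>Poly_Mapping.keys g. coef g m * dcoef sphere_form (k + m))
      = (\<Sum>m\<in>Poly_Mapping.keys g. \<Sum>j\<in>UNIV. 4 * (if k + m = xyexp 2 j 2 then coef g m else 0))" for k
    by (intro sum.cong refl) (simp add: dcoef_sphere_form coef_sphere_form sum_distrib_left if_distrib mult.commute cong: if_cong)
  also have "\<dots> k = 4 * (\<Sum>j\<in>UNIV. coef (mterm k 1 * g) (xyexp 2 j 2))" for k
    by (subst sum.swap) (simp add: pick flip: sum_distrib_left)
  finally show ?thesis
    by (simp add: perp_iff)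
qed

text \<open>
  Rows and columns of the catalecticant, both indexed by a type with \<open>n + 2\<close> elements. The variable
  \<open>y\<^sub>0\<close> is written \<open>undefined\<close>, an arbitrary index; in \<open>xyexp 2 undefined 0\<close> it has
  exponent \<open>0\<close>. The two are matched such that \<open>row a + col a\<close> is the exponent of a monomial of \<open>F\<close>.
\<close>
definition row :: "'n option option \<Rightarrow> ('n option \<Rightarrow>\<^sub>0 nat)" where
  "row a = (case a of None \<Rightarrow> xyexp 2 undefined 0
     | Some None \<Rightarrow> xyexp 0 undefined 2
     | Some (Some j) \<Rightarrow> xyexp 1 j 1)"

definition col :: "'n option option \<Rightarrow> ('n option \<Rightarrow>\<^sub>0 nat)" where
  "col b = (case b of None \<Rightarrow> xyexp 0 undefined 2
     | Some None \<Rightarrow> xyexp 2 undefined 0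
     | Some (Some j) \<Rightarrow> xyexp 1 j 1)"

lemma mdeg_row [simp]: "mdeg (row a) = 2" and mdeg_col [simp]: "mdeg (col a) = 2"
  by (simp_all add: row_def col_def split: option.split)

text \<open>
  Off the diagonal the exponent of \<open>x\<close> differs from \<open>2\<close>, or the monomial is \<open>x^2 y\<^sub>i y\<^sub>j\<close> with \<open>i \<noteq> j\<close>.
\<close>
lemma coef_sphere_form_row_col: "coef sphere_form (row a + col b) = (if a = b then 1 else 0)"
proof -
  have eq: "\<exists>i. row a + col a = xyexp 2 i 2"
  proof -
    have "row a + col a = xyexp 2 (case a of Some (Some j) \<Rightarrow> j | _ \<Rightarrow> undefined) 2"
    proof (rule poly_mapping_eqI)
      fix v
      show "expo (row a + col a) v = expo (xyexp 2 (case a of Some (Some j) \<Rightarrow> j | _ \<Rightarrow> undefined) 2) v"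
        by (cases v) (auto simp: row_def col_def lookup_add split: option.split)
    qed
    then show ?thesis ..
  qed
  have neq: "row a + col b \<noteq> xyexp 2 i 2" if "a \<noteq> b" for i
  proof
    assume *: "row a + col b = xyexp 2 i 2"
    have "expo (row a) v + expo (col b) v = expo (xyexp 2 i 2) v" for v
      by (simp flip: * add: lookup_add)
    note E = this[of None] this[of "Some i"] this
    show False
      using that E(1,2) E(3)[of "case b of Some v \<Rightarrow> v | None \<Rightarrow> None"]
      by (auto simp: row_def col_def split: option.splits if_splits)
  qed
  have inj: "xyexp 2 i 2 = xyexp 2 j 2 \<longleftrightarrow> i = j" for i j :: 'a
  proof
    assume *: "xyexp 2 i 2 = xyexp 2 j 2"
    have "expo (xyexp 2 i 2) (Some i) = expo (xyexp 2 j 2) (Some i)"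
      by (simp only: *)
    then show "i = j"
      by (simp split: if_splits)
  qed simp
  show ?thesis
  proof (cases "a = b")
    case True
    then obtain i where "row a + col b = xyexp 2 i 2"
      using eq by auto
    then show ?thesis
      using True by (simp add: coef_sphere_form inj)
  qed (simp add: coef_sphere_form neq)
qed

lemma hilbert_function_2_ge:
  fixes I :: "'n::finite option mpoly set"
  assumes I: "vs.subspace I" "I \<subseteq> perp sphere_form"
  shows "CARD('n) + 2 \<le> hilbert_function I 2"
proof -
  have "independent_mod I (\<lambda>a. mterm (row a) 1) (UNIV :: 'n option option set)"
    unfolding independent_mod_def
  proof (intro allI impI ballI)
    fix c and b :: "'n option option"
    let ?g = "\<Sum>a\<in>(UNIV :: 'n option option set). smult (c a) (mterm (row a) 1)"
    assume "?g \<in> I"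
    then have "(\<Sum>j\<in>UNIV. coef (mterm (col b) 1 * ?g) (xyexp 2 j 2)) = 0"
      using I(2) perp_sphere_form_iff by auto
    also have "mterm (col b) 1 * ?g = (\<Sum>a\<in>UNIV. mterm (row a + col b) (c a))"
      by (simp add: sum_distrib_left mult_single add.commute)
    also have "(\<Sum>j\<in>UNIV. coef \<dots> (xyexp 2 j 2))
        = (\<Sum>j\<in>UNIV. \<Sum>a\<in>UNIV. c a * (if row a + col b = xyexp 2 j 2 then 1 else 0))"
      by (simp add: lookup_sum lookup_single when_def if_distrib[where f = "\<lambda>x. _ * x"] cong: if_cong)
    also have "\<dots> = (\<Sum>a\<in>UNIV. c a * coef sphere_form (row a + col b))"
      by (subst sum.swap) (simp only: coef_sphere_form sum_distrib_left)
    also have "\<dots> = c b"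
      by (simp add: coef_sphere_form_row_col if_distrib cong: if_cong)
    finally show "c b = 0" .
  qed
  then have "CARD('n option option) \<le> hilbert_function I 2"
    by (intro card_independent_mod_le_hilbert_function[OF I(1)]) (auto intro: term_in_forms)
  then show ?thesis
    by simp
qed

section \<open>The lower bound for the cactus rank\<close>

text \<open>A regular linear form makes the Hilbert function nondecreasing, and the length is its final value.\<close>
lemma length_ge_hilbert_function:
  fixes I :: "'v::finite mpoly set"
  assumes I: "ideal I" "saturated I" and len: "has_length I r"
  shows "hilbert_function I d \<le> r"
proof -
  obtain D where D: "\<And>d. D \<le> d \<Longrightarrow> hilbert_function I d = r"
    using len by (auto simp: has_length_def eventually_sequentially)
  obtain l where l: "l \<in> forms 1" "\<And>d f. f \<in> forms d \<Longrightarrow> l * f \<in> I \<Longrightarrow> f \<in> I"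
    using exists_regular_linear_form[OF I, of D r] D by auto
  have "hilbert_function I d \<le> hilbert_function I (max d D)"
  proof (rule lift_Suc_mono_le[of "hilbert_function I"])
    fix i
    show "hilbert_function I i \<le> hilbert_function I (Suc i)"
      using l(2) by (rule hilbert_function_le_Suc[OF ideal_subspace[OF I(1)] l(1)])
  qed simp
  then show ?thesis
    using D[of "max d D"] by simp
qed

section \<open>An apolar scheme of length n + 2\<close>

text \<open>
  The ideal of the scheme defined by the annihilator of \<open>q\<close> in the chart \<open>x = 1\<close>, generated by the products
  \<open>y\<^sub>i y\<^sub>j\<close> for \<open>i \<noteq> j\<close>, the differences \<open>y\<^sub>i^2 - y\<^sub>j^2\<close> and the cubes \<open>y\<^sub>j^3\<close>. It is written as the
  common kernel of linear functionals on coefficients, so that membership and codimension can be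
  read off directly.
\<close>
definition local_ideal :: "'n::finite option mpoly set" where
  "local_ideal = {f. \<forall>c. (\<forall>j. coef f (xyexp c j 0) = 0 \<and> coef f (xyexp c j 1) = 0) \<and>
     (\<Sum>j\<in>UNIV. coef f (xyexp c j 2)) = 0}"

lemma coef_x_power_mult:
  "coef (mterm (pow None b) 1 * f) (xyexp c j e) = (if b \<le> c then coef f (xyexp (c - b) j e) else 0)"
proof (cases "b \<le> c")
  case True
  then have "xyexp c j e = pow None b + xyexp (c - b) j e"
    by (simp add: xyexp_def flip: add.assoc single_add)
  then show ?thesis
    using True by (simp add: coef_term_mult)
next
  case False
  have "xyexp c j e \<noteq> pow None b + l" for l
  proof
    assume "xyexp c j e = pow None b + l"
    then have "expo (xyexp c j e) None = expo (pow None b + l) None"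
      by simp
    then show False
      using False by (simp add: lookup_add)
  qed
  then show ?thesis
    using False by (simp add: coef_term_mult_eq_0)
qed

text \<open>
  Multiplication by a power of \<open>x\<close> shifts the functionals. A monomial that contains some \<open>y\<^sub>i\<close> turns each
  of them into coefficients at \<open>x^c y\<^sub>i^e\<close> with \<open>e \<le> 1\<close>, which vanish.
\<close>
lemma ideal_local_ideal: "ideal (local_ideal :: 'n::finite option mpoly set)"
proof (rule ideal_if_closed_under_terms)
  show "vs.subspace (local_ideal :: 'n option mpoly set)"
    by (auto simp: vs.subspace_def local_ideal_def lookup_add sum.distrib simp flip: sum_distrib_left)
  fix m and f :: "'n option mpoly"
  assume f: "f \<in> local_ideal"
  show "mterm m 1 * f \<in> local_ideal"
  proof (cases "\<exists>i. expo m (Some i) \<noteq> 0")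
    case False
    have "m = pow None (expo m None)"
    proof (rule poly_mapping_eqI)
      fix v
      show "expo m v = expo (pow None (expo m None)) v"
        using False by (cases v) (auto simp: lookup_single)
    qed
    then obtain b where "m = pow None b" ..
    moreover have "coef f (xyexp c j 0) = 0" "coef f (xyexp c j 1) = 0" "(\<Sum>j\<in>UNIV. coef f (xyexp c j 2)) = 0" for c j
      using f by (simp_all add: local_ideal_def)
    ultimately show ?thesis
      unfolding local_ideal_def mem_Collect_eq by (simp add: coef_x_power_mult sum_if_const del: One_nat_def)
  next
    case True
    then obtain i where i: "expo m (Some i) \<noteq> 0"
      by auto
    have "coef (mterm m 1 * f) (xyexp c j e) = 0" if "e \<le> 2" for c j e
    proof (cases "\<exists>l. xyexp c j e = m + l")
      case True
      then obtain l where l: "xyexp c j e = m + l"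
        by auto
      have E: "expo (xyexp c j e) v = expo m v + expo l v" for v
        by (simp add: l lookup_add)
      have "i = j"
        using E[of "Some i"] i by (simp split: if_splits)
      then have e: "expo l (Some j) \<le> 1"
        using E[of "Some j"] i that by simp
      have "l = xyexp (expo l None) j (expo l (Some j))"
      proof (rule poly_mapping_eqI)
        fix v
        show "expo l v = expo (xyexp (expo l None) j (expo l (Some j))) v"
          using E[of v] by (cases v) auto
      qed
      then obtain c' e' where "l = xyexp c' j e'" "e' \<le> 1"
        using e by blast
      then have "coef f l = 0"
        using f by (cases e') (auto simp: local_ideal_def)
      then show ?thesis
        by (simp add: l coef_term_mult)
    qed (simp add: coef_term_mult_eq_0)
    then show ?thesis
      by (simp add: local_ideal_def)
  qed
qed

lemma x_power_regular_local_ideal: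
  assumes "Var None ^ k * f \<in> local_ideal"
  shows "f \<in> local_ideal"
proof -
  have "coef f (xyexp c j e) = coef (Var None ^ k * f) (xyexp (c + k) j e)" for c j e
    by (simp add: Var_power coef_x_power_mult)
  then show ?thesis
    using assms by (simp add: local_ideal_def)
qed

lemma saturated_local_ideal: "saturated local_ideal"
proof -
  have "Var None ^ k \<in> forms k" for k
    using forms_power[OF Var_in_forms[of None], of k] by simp
  then show ?thesis
    unfolding saturated_def by (blast intro: x_power_regular_local_ideal)
qed

lemma homogeneous_local_ideal: "homogeneous_ideal local_ideal"
  by (auto simp: homogeneous_ideal_def ideal_local_ideal)
    (auto simp: local_ideal_def coef_hom_component sum_if_const)

text \<open>By \<open>perp_sphere_form_iff\<close>, since the ideal is closed under multiplication by monomials.\<close>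
lemma local_ideal_subset_perp: "local_ideal \<subseteq> perp sphere_form"
proof
  fix g
  assume "g \<in> local_ideal"
  then have "mterm k 1 * g \<in> local_ideal" for k
    by (rule ideal_mult[OF ideal_local_ideal])
  then show "g \<in> perp sphere_form"
    by (simp add: perp_sphere_form_iff local_ideal_def)
qed

text \<open>On forms of a fixed degree at most \<open>n + 2\<close> of the functionals that define the ideal are nonzero.\<close>
lemma hilbert_function_local_ideal_le:
  "hilbert_function (local_ideal :: 'n::finite option mpoly set) d \<le> CARD('n) + 2"
proof (rule ccontr)
  assume large: "\<not> ?thesis"
  obtain A :: "'n option mpoly set" where A: "finite A" "A \<subseteq> forms d" "card A = hilbert_function (local_ideal :: 'n option mpoly set) d"
      "independent_mod local_ideal id A"
    by (rule hilbert_function_basis[OF ideal_subspace[OF ideal_local_ideal], where d = d])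
  define M :: "'n option mpoly \<Rightarrow> 'n option option \<Rightarrow> complex" where
    "M a b = (case b of None \<Rightarrow> coef a (pow None d)
       | Some None \<Rightarrow> (\<Sum>j\<in>UNIV. coef a (xyexp (d - 2) j 2))
       | Some (Some j) \<Rightarrow> coef a (xyexp (d - 1) j 1))" for a b
  obtain c where c: "\<exists>a\<in>A. c a \<noteq> 0" "\<And>b. (\<Sum>a\<in>A. c a * M a b) = 0"
    using more_unknowns_than_equations[of "UNIV :: 'n option option set" A M] A large by auto
  define f where "f = (\<Sum>a\<in>A. smult (c a) a)"
  have "f \<in> forms d"
    unfolding f_def using A(2) by (intro vs.subspace_sum[OF subspace_forms] vs.subspace_scale[OF subspace_forms]) auto
  then have f: "coef f (xyexp i j e) = 0" if "i + e \<noteq> d" for i j e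
    using that by (auto simp: forms_iff)
  have 0: "coef f (pow None d) = 0"
    using c(2)[of None] by (simp add: f_def M_def lookup_sum)
  have 1: "coef f (xyexp (d - 1) j 1) = 0" for j
    using c(2)[of "Some (Some j)"] by (simp add: f_def M_def lookup_sum)
  have 2: "(\<Sum>j\<in>UNIV. coef f (xyexp (d - 2) j 2)) = 0"
    using c(2)[of "Some None"] by (simp add: f_def M_def lookup_sum sum_distrib_left sum.swap[of _ UNIV A])
  have "coef f (xyexp i j 0) = 0" for i j
    using f[of i 0 j] 0 by (cases "i = d") (simp_all add: xyexp_0)
  moreover have "coef f (xyexp i j 1) = 0" for i j
    using f[of i 1 j] 1[of j] by (cases "i + 1 = d") auto
  moreover have "(\<Sum>j\<in>UNIV. coef f (xyexp i j 2)) = 0" for i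
    using f[of i 2] 2 by (cases "i + 2 = d") auto
  ultimately have "f \<in> local_ideal"
    by (simp add: local_ideal_def)
  then show False
    using c(1) independent_modD[OF A(4), of c] by (auto simp: f_def)
qed

text \<open>
  The lower bound is the catalecticant estimate in degree 2, carried to higher degrees by
  multiplication by the nonzerodivisor \<open>x\<close>.
\<close>
lemma has_length_local_ideal:
  "has_length (local_ideal :: 'n::finite option mpoly set) (CARD('n) + 2)"
proof -
  have sub: "vs.subspace (local_ideal :: 'n option mpoly set)"
    by (rule ideal_subspace[OF ideal_local_ideal])
  have "hilbert_function (local_ideal :: 'n option mpoly set) d = CARD('n) + 2" if d: "2 \<le> d" for d
  proof (rule antisym[OF hilbert_function_local_ideal_le])
    let ?h = "hilbert_function (local_ideal :: 'n option mpoly set)"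
    have "CARD('n) + 2 \<le> ?h 2"
      by (rule hilbert_function_2_ge[OF sub local_ideal_subset_perp])
    also have "\<dots> \<le> ?h d"
    proof (rule lift_Suc_mono_le[of ?h, OF _ d])
      fix i
      show "?h i \<le> ?h (Suc i)"
        using x_power_regular_local_ideal[of 1]
        by (intro hilbert_function_le_Suc[OF sub Var_in_forms[of None]]) simp
    qed
    finally show "CARD('n) + 2 \<le> ?h d" .
  qed
  then show ?thesis
    unfolding has_length_def eventually_sequentially by blast
qed

text \<open>The ideal generated by all the \<open>y\<^sub>j\<close>, of the point \<open>(1 : 0 : \<dots> : 0)\<close>.\<close>
definition point_ideal :: "'n::finite option mpoly set" where
  "point_ideal = {f. \<forall>k. coef f (pow None k) = 0}"

text \<open>Setting all \<open>y\<^sub>j\<close> to zero is a ring homomorphism to the polynomials in \<open>x\<close>.\<close>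
lemma coef_mult_x_power:
  fixes f g :: "'n::finite option mpoly"
  shows "coef (f * g) (pow None k) = (\<Sum>i\<le>k. coef f (pow None i) * coef g (pow None (k - i)))"
proof -
  have "coef (mterm m a * g) (pow None k)
      = (\<Sum>i\<le>k. (if m = pow None i then a else 0) * coef g (pow None (k - i)))" for m a
  proof (cases "\<exists>i\<le>k. m = pow None i")
    case True
    then obtain i where i: "i \<le> k" "m = pow None i"
      by auto
    have "coef (mterm m a * g) (pow None k) = a * coef g (pow None (k - i))"
      using i coef_term_mult[of m a g "pow None (k - i)"] by (simp flip: single_add)
    moreover have "pow None i = (pow None i' :: 'n option \<Rightarrow>\<^sub>0 nat) \<longleftrightarrow> i' = i" for i'
      by (metis lookup_single_eq)
    ultimately show ?thesis
      using i by (simp add: if_distrib[where f = "\<lambda>x. x * _"] cong: if_cong)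
  next
    case False
    have "pow None k \<noteq> m + l" for l
    proof
      assume *: "pow None k = m + l"
      have E: "expo (pow None k) v = expo m v + expo l v" for v
        by (simp add: * lookup_add)
      have "m = pow None (expo m None)"
      proof (rule poly_mapping_eqI)
        fix v
        show "expo m v = expo (pow None (expo m None)) v"
          using E[of v] by (cases v) (auto simp: lookup_single)
      qed
      moreover have "expo m None \<le> k"
        using E[of None] by simp
      ultimately show False
        using False by auto
    qed
    then have "coef (mterm m a * g) (pow None k) = 0"
      by (rule coef_term_mult_eq_0)
    then show ?thesis
      using False by auto
  qed
  then have "coef (f * g) (pow None k)
      = (\<Sum>m\<in>Poly_Mapping.keys f. \<Sum>i\<le>k. (if m = pow None i then coef f m else 0) * coef g (pow None (k - i)))"
    by (subst mpoly_sum_terms[of f]) (simp add: sum_distrib_right lookup_sum)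
  also have "\<dots> = (\<Sum>i\<le>k. (\<Sum>m\<in>Poly_Mapping.keys f. if m = pow None i then coef f m else 0) * coef g (pow None (k - i)))"
    by (subst sum.swap) (simp only: sum_distrib_right)
  also have "\<dots> = (\<Sum>i\<le>k. coef f (pow None i) * coef g (pow None (k - i)))"
    by (intro sum.cong refl) (simp add: in_keys_iff)
  finally show ?thesis .
qed

text \<open>The lowest powers of \<open>x\<close> in \<open>f\<close> and \<open>g\<close> multiply to a power of \<open>x\<close> that nothing can cancel.\<close>
lemma prime_point_ideal:
  assumes "f * g \<in> point_ideal"
  shows "f \<in> point_ideal \<or> g \<in> point_ideal"
proof (rule ccontr)
  assume "\<not> ?thesis"
  then have ex: "\<exists>a. coef f (pow None a) \<noteq> 0" "\<exists>b. coef g (pow None b) \<noteq> 0"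
    by (auto simp: point_ideal_def)
  define a where "a = (LEAST a. coef f (pow None a) \<noteq> 0)"
  define b where "b = (LEAST b. coef g (pow None b) \<noteq> 0)"
  have a: "coef f (pow None a) \<noteq> 0" and b: "coef g (pow None b) \<noteq> 0"
    unfolding a_def b_def using LeastI_ex[OF ex(1)] LeastI_ex[OF ex(2)] by simp_all
  have a': "coef f (pow None i) = 0" if "i < a" for i
    using that not_less_Least unfolding a_def by blast
  have b': "coef g (pow None i) = 0" if "i < b" for i
    using that not_less_Least unfolding b_def by blast
  have "coef f (pow None i) * coef g (pow None (a + b - i)) = 0" if "i \<in> {..a + b} - {a}" for i
  proof (cases "i < a")
    case False
    then have "a + b - i < b"
      using that by auto
    then show ?thesis
      by (simp add: b')
  qed (simp add: a')
  then have "(\<Sum>i\<le>a + b. coef f (pow None i) * coef g (pow None (a + b - i)))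
      = (\<Sum>i\<in>{a}. coef f (pow None i) * coef g (pow None (a + b - i)))"
    by (intro sum.mono_neutral_right) auto
  then have "coef (f * g) (pow None (a + b)) = coef f (pow None a) * coef g (pow None b)"
    by (simp add: coef_mult_x_power)
  then show False
    using a b assms by (simp add: point_ideal_def)
qed

text \<open>
  A homogeneous prime over the ideal contains each \<open>y\<^sub>j\<close> because it contains \<open>y\<^sub>j^3\<close>. If it were larger
  than the ideal generated by them, it would contain a power of \<open>x\<close> and then all variables.
\<close>
lemma proj_points_local_ideal:
  "proj_points (local_ideal :: 'n::finite option mpoly set) = {point_ideal}"
proof (intro equalityI subsetI)
  fix P :: "'n option mpoly set"
  assume "P \<in> proj_points local_ideal"
  then have P: "ideal P" "\<And>f d. f \<in> P \<Longrightarrow> hom_component d f \<in> P"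
      "\<And>f g. f * g \<in> P \<Longrightarrow> f \<in> P \<or> g \<in> P" "local_ideal \<subseteq> P" and proper: "\<exists>v. Var v \<notin> P"
    by (auto simp: proj_points_def homogeneous_ideal_def)
  note sub = ideal_subspace[OF P(1)]
  have prime_power: "f \<in> P" if "f ^ k \<in> P" for f k
  proof (rule ccontr)
    assume "f \<notin> P"
    then have "1 \<in> P"
      using that P(3) by (induction k) auto
    then show False
      using proper ideal_mult[OF P(1), of 1] by auto
  qed
  have Y: "Var (Some j) \<in> P" for j
  proof (rule prime_power)
    have "coef (Var (Some j) ^ 3) (xyexp c i e) = 0" if "e \<le> 2" for c i e
    proof -
      have "pow (Some j) 3 \<noteq> xyexp c i e"
      proof
        assume "pow (Some j) 3 = xyexp c i e"
        then have "expo (pow (Some j) 3) (Some j) = expo (xyexp c i e) (Some j)"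
          by simp
        then show False
          using that by (simp split: if_splits)
      qed
      then show ?thesis
        by (simp add: Var_power lookup_single)
    qed
    then show "Var (Some j) ^ 3 \<in> P"
      using P(4) by (auto simp: local_ideal_def)
  qed
  have X: "Var None \<notin> P"
    using proper Y by (metis option.exhaust)
  have le: "f \<in> P" if f: "f \<in> point_ideal" for f
  proof -
    have "mterm m (coef f m) \<in> P" if "m \<in> Poly_Mapping.keys f" for m
    proof -
      have "coef f m \<noteq> 0"
        using that by (simp add: in_keys_iff)
      moreover have "coef f (pow None k) = 0" for k
        using f by (simp add: point_ideal_def)
      ultimately have "m \<noteq> pow None (expo m None)"
        by metis
      then obtain v where v: "expo m v \<noteq> expo (pow None (expo m None)) v"
        by (meson poly_mapping_eqI)
      then obtain j where j: "expo m (Some j) \<noteq> 0"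
        by (cases v) (auto simp: lookup_single)
      have "m = (m - pow (Some j) 1) + pow (Some j) 1"
        using j by (rule exponent_split)
      then have "mterm m (coef f m) = mterm (m - pow (Some j) 1) (coef f m) * Var (Some j)"
        by (simp add: Var_def mult_single)
      then show ?thesis
        using ideal_mult[OF P(1) Y] by simp
    qed
    then show ?thesis
      by (subst mpoly_sum_terms) (intro vs.subspace_sum[OF sub])
  qed
  have "f \<in> point_ideal" if f: "f \<in> P" for f
  proof (rule ccontr)
    assume "f \<notin> point_ideal"
    then obtain k where k: "coef f (pow None k) \<noteq> 0"
      by (auto simp: point_ideal_def)
    let ?t = "mterm (pow None k) (coef f (pow None k))"
    have "hom_component k f - ?t \<in> P"
    proof (rule le)
      have "coef (hom_component k f - ?t) (pow None i) = 0" for i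
        by (cases "i = k") (auto simp: lookup_minus coef_hom_component lookup_single when_def pow_eq_iff)
      then show "hom_component k f - ?t \<in> point_ideal"
        by (simp add: point_ideal_def)
    qed
    then have "hom_component k f - (hom_component k f - ?t) \<in> P"
      using P(2)[OF f] vs.subspace_diff[OF sub] by blast
    then have "?t \<in> P"
      by simp
    then have "smult (inverse (coef f (pow None k))) ?t \<in> P"
      by (rule vs.subspace_scale[OF sub])
    then have "Var None ^ k \<in> P"
      using k by (simp add: Var_power)
    then show False
      using X prime_power by blast
  qed
  then show "P \<in> {point_ideal}"
    using le by auto
next
  fix P :: "'n option mpoly set"
  assume "P \<in> {point_ideal}"
  moreover have "ideal (point_ideal :: 'n option mpoly set)"
    by (auto simp: ideal_iff point_ideal_def lookup_add coef_mult_x_power)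
  moreover have "hom_component d f \<in> point_ideal" if "f \<in> point_ideal" for d and f :: "'n option mpoly"
    using that by (simp add: point_ideal_def coef_hom_component)
  moreover have "Var None \<notin> (point_ideal :: 'n option mpoly set)"
    by (auto simp: point_ideal_def Var_def intro!: exI[of _ 1])
  moreover have "local_ideal \<subseteq> (point_ideal :: 'n option mpoly set)"
    by (auto simp: local_ideal_def point_ideal_def xyexp_0)
  moreover have "\<forall>f g. f * g \<in> (point_ideal :: 'n option mpoly set) \<longrightarrow> f \<in> point_ideal \<or> g \<in> point_ideal"
    using prime_point_ideal by blast
  ultimately show "P \<in> proj_points local_ideal"
    by (simp add: proj_points_def homogeneous_ideal_def) blast
qed

lemma cactus_rank_sphere_form: "cactus_rank (sphere_form :: 'n::finite option mpoly) = enat (CARD('n) + 2)"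
proof (rule antisym)
  have "zero_dimensional (local_ideal :: 'n option mpoly set)"
    by (simp add: zero_dimensional_def proj_points_local_ideal)
  then show "cactus_rank (sphere_form :: 'n option mpoly) \<le> enat (CARD('n) + 2)"
    unfolding cactus_rank_def
    using homogeneous_local_ideal saturated_local_ideal has_length_local_ideal
      local_ideal_subset_perp
    by (intro Inf_lower) blast
  show "enat (CARD('n) + 2) \<le> cactus_rank (sphere_form :: 'n option mpoly)"
    unfolding cactus_rank_def
  proof (intro Inf_greatest)
    fix s
    assume "s \<in> {enat r | r I. homogeneous_ideal I \<and> saturated I \<and> zero_dimensional I \<and>
      has_length I r \<and> I \<subseteq> perp (sphere_form :: 'n option mpoly)}"
    then obtain r I where s: "s = enat r" and I: "homogeneous_ideal I" "saturated I" "has_length I r"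
        "I \<subseteq> perp (sphere_form :: 'n option mpoly)"
      by auto
    have "ideal I"
      using I(1) by (simp add: homogeneous_ideal_def)
    then have "CARD('n) + 2 \<le> r"
      using hilbert_function_2_ge[OF ideal_subspace I(4)] length_ge_hilbert_function[of I r 2] I
      by (meson order_trans)
    then show "enat (CARD('n) + 2) \<le> s"
      by (simp add: s)
  qed
qed

section \<open>Powers of linear forms\<close>

definition eval_monomial :: "('v \<Rightarrow> complex) \<Rightarrow> ('v::finite \<Rightarrow>\<^sub>0 nat) \<Rightarrow> complex" where
  "eval_monomial l m = (\<Prod>v\<in>UNIV. l v ^ expo m v)"

lemma eval_monomial_add: "eval_monomial l (m + k) = eval_monomial l m * eval_monomial l k"
  by (simp add: eval_monomial_def lookup_add power_add prod.distrib)

lemma eval_monomial_pow: "eval_monomial l (pow v 1) = l v"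
proof -
  have "eval_monomial l (pow v 1) = (\<Prod>w\<in>UNIV. if w = v then l v else 1)"
    unfolding eval_monomial_def by (intro prod.cong) (auto simp: lookup_single when_def)
  then show ?thesis
    by simp
qed

lemma linear_form_expand:
  fixes L :: "'v::finite mpoly"
  assumes "L \<in> forms 1"
  shows "L = (\<Sum>v\<in>UNIV. smult (coef L (pow v 1)) (Var v))"
proof (rule poly_mapping_eqI)
  fix m
  have sum: "coef (\<Sum>v\<in>UNIV. smult (coef L (pow v 1)) (Var v)) m
      = (\<Sum>v\<in>UNIV. if pow v 1 = m then coef L m else 0)"
    unfolding lookup_sum by (intro sum.cong) (auto simp: Var_def lookup_single when_def)
  show "coef L m = coef (\<Sum>v\<in>UNIV. smult (coef L (pow v 1)) (Var v)) m"
  proof (cases "mdeg m = 1")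
    case True
    then obtain w where w: "m = pow w 1"
      by (rule mdeg_eq_1D)
    have "pow v 1 = pow w (1::nat) \<longleftrightarrow> v = w" for v
      by (metis lookup_single_eq lookup_single_not_eq zero_neq_one)
    then show ?thesis
      unfolding sum by (simp add: w)
  next
    case False
    then have "coef L m = 0"
      using assms by (auto simp: forms_iff)
    then show ?thesis
      unfolding sum by (simp cong: if_cong)
  qed
qed

lemma dcoef_Var_mult:
  "dcoef (Var v * p) m = (if expo m v = 0 then 0 else of_nat (expo m v) * dcoef p (m - pow v 1))"
proof (cases "expo m v = 0")
  case True
  have "m \<noteq> pow v 1 + l" for l
  proof
    assume "m = pow v 1 + l"
    then have "expo m v = expo (pow v 1 + l) v"
      by simp
    then show False
      using True by (simp add: lookup_add)
  qed
  then show ?thesis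
    using True by (simp add: dcoef_def Var_def coef_term_mult_eq_0)
next
  case False
  define k where "k = m - pow v 1"
  have m: "m = k + pow v 1"
    using False unfolding k_def by (rule exponent_split)
  have "coef (Var v * p) m = coef p k"
    using coef_term_mult[of "pow v 1" 1 p k] by (simp add: m Var_def add.commute)
  moreover have "mfact m = of_nat (expo m v) * mfact k"
    unfolding m mfact_add_pow by (simp add: lookup_add)
  ultimately show ?thesis
    using False by (simp add: dcoef_def del: One_nat_def flip: k_def)
qed

lemma dcoef_sum: "dcoef (\<Sum>a\<in>A. p a) m = (\<Sum>a\<in>A. dcoef (p a) m)"
  by (simp add: dcoef_def lookup_sum sum_distrib_left)

lemma dcoef_smult: "dcoef (smult c p) m = c * dcoef p m"
  by (simp add: dcoef_def)

lemma dcoef_linear_power: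
  fixes l :: "'v::finite \<Rightarrow> complex"
  shows "dcoef ((\<Sum>v\<in>UNIV. smult (l v) (Var v)) ^ d) m
    = (if mdeg m = d then fact d * eval_monomial l m else 0)"
proof (induction d arbitrary: m)
  case 0
  have "mdeg m = 0 \<longleftrightarrow> m = 0"
    by (auto simp: mdeg_def poly_mapping_eq_iff fun_eq_iff)
  then show ?case
    by (auto simp: dcoef_def lookup_one mfact_def eval_monomial_def)
next
  case (Suc d)
  let ?L = "\<Sum>v\<in>UNIV. smult (l v) (Var v)"
  have summand: "l v * dcoef (Var v * ?L ^ d) m
      = of_nat (expo m v) * (if mdeg m = Suc d then fact d * eval_monomial l m else 0)" for v
  proof (cases "expo m v = 0")
    case False
    define k where "k = m - pow v 1"
    have m: "m = k + pow v 1"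
      using False unfolding k_def by (rule exponent_split)
    have "eval_monomial l m = eval_monomial l k * l v"
      unfolding m eval_monomial_add eval_monomial_pow ..
    moreover have "mdeg m = Suc d \<longleftrightarrow> mdeg k = d"
      by (simp add: m)
    ultimately show ?thesis
      using False by (simp add: dcoef_Var_mult Suc.IH del: One_nat_def flip: k_def)
  qed (simp add: dcoef_Var_mult)
  have "dcoef (?L ^ Suc d) m = (\<Sum>v\<in>UNIV. l v * dcoef (Var v * ?L ^ d) m)"
    by (simp add: sum_distrib_right smult_mult dcoef_sum dcoef_smult)
  also have "\<dots> = of_nat (mdeg m) * (if mdeg m = Suc d then fact d * eval_monomial l m else 0)"
    unfolding summand by (simp add: mdeg_def sum_distrib_right)
  also have "\<dots> = (if mdeg m = Suc d then fact (Suc d) * eval_monomial l m else 0)"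
    by simp
  finally show ?case .
qed

section \<open>The lower bound for the border rank\<close>

text \<open>
  By \<open>dcoef_linear_power\<close> the catalecticant of a fourth power of a linear form has rank at most one,
  so a vector orthogonal to \<open>r\<close> given ones is in the kernel of the sum.
\<close>
lemma catalecticant_kernel:
  fixes L :: "nat \<Rightarrow> 'n::finite option mpoly"
  assumes L: "\<And>i. i < r \<Longrightarrow> L i \<in> forms 1" and r: "r < CARD('n) + 2"
  obtains c where "\<exists>a. c a \<noteq> 0"
    "\<And>b. (\<Sum>a\<in>UNIV. c a * dcoef (\<Sum>i<r. smult (\<alpha> i) (L i ^ 4)) (row a + col b)) = 0"
proof -
  define l where "l i = (\<lambda>v. coef (L i) (pow v 1))" for i
  have power: "dcoef (L i ^ 4) (row a + col b)
      = fact 4 * eval_monomial (l i) (row a) * eval_monomial (l i) (col b)" if "i < r" for i a b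
    by (subst linear_form_expand[OF L[OF that]], subst dcoef_linear_power)
       (simp add: eval_monomial_add del: One_nat_def flip: l_def)
  obtain c where c: "\<exists>a\<in>(UNIV :: 'n option option set). c a \<noteq> 0"
      "\<forall>i\<in>{..<r}. (\<Sum>a\<in>UNIV. c a * eval_monomial (l i) (row a)) = 0"
    using more_unknowns_than_equations[of "{..<r}" "UNIV :: 'n option option set"
        "\<lambda>a i. eval_monomial (l i) (row a)"] r by auto
  have "(\<Sum>a\<in>UNIV. c a * dcoef (\<Sum>i<r. smult (\<alpha> i) (L i ^ 4)) (row a + col b)) = 0" for b
  proof -
    have "(\<Sum>a\<in>UNIV. c a * dcoef (\<Sum>i<r. smult (\<alpha> i) (L i ^ 4)) (row a + col b))
        = (\<Sum>a\<in>UNIV. \<Sum>i<r. \<alpha> i * fact 4 * eval_monomial (l i) (col b)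
            * (c a * eval_monomial (l i) (row a)))"
      by (intro sum.cong refl) (simp add: dcoef_sum dcoef_smult power sum_distrib_left mult_ac)
    also have "\<dots> = (\<Sum>i<r. \<alpha> i * fact 4 * eval_monomial (l i) (col b)
            * (\<Sum>a\<in>UNIV. c a * eval_monomial (l i) (row a)))"
      by (subst sum.swap) (simp only: sum_distrib_left)
    also have "\<dots> = 0"
      using c(2) by (intro sum.neutral) auto
    finally show ?thesis .
  qed
  then show ?thesis
    using that c(1) by blast
qed

text \<open>The equation at an index where \<open>norm (c b)\<close> is largest cannot balance.\<close>
lemma diagonally_dominant_kernel:
  fixes M :: "'i::finite \<Rightarrow> 'i \<Rightarrow> complex"
  assumes dominant: "\<And>b. (\<Sum>a\<in>UNIV - {b}. norm (M a b)) < norm (M b b)"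
    and kernel: "\<And>b. (\<Sum>a\<in>UNIV. c a * M a b) = 0"
  shows "c a = 0"
proof (rule ccontr)
  assume a: "c a \<noteq> 0"
  have "Max (range (\<lambda>a. norm (c a))) \<in> range (\<lambda>a. norm (c a))"
    by (rule Max_in) auto
  then obtain b where b: "Max (range (\<lambda>a. norm (c a))) = norm (c b)"
    by (rule imageE)
  have max: "norm (c i) \<le> norm (c b)" for i
    unfolding b[symmetric] by (rule Max_ge) auto
  have pos: "0 < norm (c b)"
    using a max[of a] by (metis less_le_trans zero_less_norm_iff)
  have "c b * M b b + (\<Sum>a\<in>UNIV - {b}. c a * M a b) = 0"
    using kernel[of b] by (simp add: sum.remove[of UNIV b])
  then have "norm (c b) * norm (M b b) = norm (\<Sum>a\<in>UNIV - {b}. c a * M a b)"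
    by (metis add_eq_0_iff norm_minus_cancel norm_mult)
  also have "\<dots> \<le> (\<Sum>a\<in>UNIV - {b}. norm (c a) * norm (M a b))"
    by (rule order_trans[OF norm_sum]) (simp add: norm_mult)
  also have "\<dots> \<le> (\<Sum>a\<in>UNIV - {b}. norm (c b) * norm (M a b))"
    by (intro sum_mono mult_right_mono max) simp
  also have "\<dots> = norm (c b) * (\<Sum>a\<in>UNIV - {b}. norm (M a b))"
    by (simp add: sum_distrib_left)
  also have "\<dots> < norm (c b) * norm (M b b)"
    using dominant[of b] pos by simp
  finally show False
    by simp
qed

text \<open>Near \<open>F\<close> the catalecticant is diagonally dominant, its limit being \<open>4\<close> times the identity matrix.\<close>
lemma eventually_waring_rank_ge:
  fixes G :: "nat \<Rightarrow> 'n::finite option mpoly"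
  assumes lim: "\<And>m. (\<lambda>k. coef (G k) m) \<longlonglongrightarrow> coef sphere_form m"
  shows "\<forall>\<^sub>F k in sequentially. enat (CARD('n) + 2) \<le> waring_rank 4 (G k)"
proof -
  define M where "M k a b = dcoef (G k) (row a + col b)" for k and a b :: "'n option option"
  have "(\<lambda>k. M k a b) \<longlonglongrightarrow> (if a = b then 4 else 0)" for a b
  proof -
    have "(\<lambda>k. M k a b) \<longlonglongrightarrow> dcoef sphere_form (row a + col b)"
      unfolding M_def dcoef_def by (intro tendsto_intros lim)
    then show ?thesis
      by (cases "a = b") (simp_all add: dcoef_sphere_form coef_sphere_form_row_col)
  qed
  note M = this tendsto_norm[OF this]
  have "\<forall>\<^sub>F k in sequentially. 0 < norm (M k b b) - (\<Sum>a\<in>UNIV - {b}. norm (M k a b))" for b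
  proof (rule order_tendstoD(1))
    have "(\<lambda>k. norm (M k b b) - (\<Sum>a\<in>UNIV - {b}. norm (M k a b)))
        \<longlonglongrightarrow> norm (if b = b then 4 else 0 :: complex) - (\<Sum>a\<in>UNIV - {b}. norm (if a = b then 4 else 0 :: complex))"
      by (intro tendsto_diff tendsto_sum M)
    also have "norm (if b = b then 4 else 0 :: complex) - (\<Sum>a\<in>UNIV - {b}. norm (if a = b then 4 else 0 :: complex)) = 4"
      by simp
    finally show "(\<lambda>k. norm (M k b b) - (\<Sum>a\<in>UNIV - {b}. norm (M k a b))) \<longlonglongrightarrow> 4" .
  qed simp
  then have "\<forall>\<^sub>F k in sequentially. \<forall>b\<in>UNIV. 0 < norm (M k b b) - (\<Sum>a\<in>UNIV - {b}. norm (M k a b))"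
    by (intro eventually_ball_finite) auto
  then show ?thesis
  proof (rule eventually_mono)
    fix k
    assume dominant: "\<forall>b\<in>UNIV. 0 < norm (M k b b) - (\<Sum>a\<in>UNIV - {b}. norm (M k a b))"
    show "enat (CARD('n) + 2) \<le> waring_rank 4 (G k)"
      unfolding waring_rank_def
    proof (intro Inf_greatest)
      fix s
      assume "s \<in> {enat r | r. \<exists>(\<alpha> :: nat \<Rightarrow> complex) L. (\<forall>i<r. L i \<in> forms 1) \<and>
        G k = (\<Sum>i<r. smult (\<alpha> i) (L i ^ 4))}"
      then obtain r and \<alpha> :: "nat \<Rightarrow> complex" and L where s: "s = enat r" and L: "\<And>i. i < r \<Longrightarrow> L i \<in> forms 1"
          and G: "G k = (\<Sum>i<r. smult (\<alpha> i) (L i ^ 4))"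
        by auto
      have "\<not> r < CARD('n) + 2"
      proof
        assume "r < CARD('n) + 2"
        then obtain c where c: "\<exists>a. c a \<noteq> 0" "\<And>b. (\<Sum>a\<in>UNIV. c a * M k a b) = 0"
          using catalecticant_kernel[of r L \<alpha>] L unfolding M_def G by blast
        then show False
          using diagonally_dominant_kernel[of "M k" c] dominant by auto
      qed
      then show "enat (CARD('n) + 2) \<le> s"
        by (simp add: s)
    qed
  qed
qed

section \<open>Approximation by sums of n + 2 powers\<close>

lemma waring_rank_le_card:
  assumes A: "finite A" and L: "\<And>a. a \<in> A \<Longrightarrow> L a \<in> forms 1"
  shows "waring_rank d (\<Sum>a\<in>A. smult (\<alpha> a) (L a ^ d)) \<le> enat (card A)"
proof -
  obtain h where h: "bij_betw h {0..<card A} A"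
    using ex_bij_betw_nat_finite[OF A] by auto
  then have h': "bij_betw h {..<card A} A"
    by (simp add: atLeast0LessThan)
  have "(\<Sum>a\<in>A. smult (\<alpha> a) (L a ^ d)) = (\<Sum>i<card A. smult (\<alpha> (h i)) (L (h i) ^ d))"
    by (rule sum.reindex_bij_betw[OF h', symmetric])
  moreover have "\<forall>i<card A. L (h i) \<in> forms 1"
    using L h' by (auto simp: bij_betw_def)
  ultimately show ?thesis
    unfolding waring_rank_def
    by (intro Inf_lower CollectI exI[of _ "card A"] conjI refl exI[of _ "\<lambda>i. \<alpha> (h i)"] exI[of _ "\<lambda>i. L (h i)"]) auto
qed

lemma quartic_power_expand:
  "(p + smult e q) ^ 4 = p ^ 4 + smult (4 * e) (p ^ 3 * q) + smult (6 * e ^ 2) (p ^ 2 * q ^ 2)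
     + smult (4 * e ^ 3) (p * q ^ 3) + smult (e ^ 4) (q ^ 4)"
proof -
  define E :: "'a mpoly" where "E = mterm 0 e"
  have mult: "(mterm 0 (a * b) :: 'a mpoly) = mterm 0 a * mterm 0 b" for a b
    by (simp add: mult_single)
  have "mterm 0 (e ^ k) = E ^ k" for k
    by (induction k) (simp_all add: E_def mult)
  then have E: "mterm 0 (c * e ^ k) = mterm 0 c * E ^ k" for c k
    by (simp add: mult)
  have "smult e q = E * q" "smult (4 * e) u = 4 * E * u" "smult (6 * e ^ 2) u = 6 * E ^ 2 * u"
      "smult (4 * e ^ 3) u = 4 * E ^ 3 * u" "smult (e ^ 4) u = E ^ 4 * u" for u
    using E[of 4 1] E[of 6 2] E[of 4 3] E[of 1 4] by (simp_all add: smult_def E_def)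
  then show ?thesis
    by (simp add: eval_nat_numeral algebra_simps)
qed

text \<open>
  The points \<open>x\<close>, \<open>x + e y\<^sub>j\<close> and \<open>x - e^2 Y\<close> converge to a single point. The weight \<open>1/e\<close> of the last one
  relative to the \<open>x + e y\<^sub>j\<close> makes the terms in \<open>x^3\<close> cancel, while its own contribution \<open>e^3 x^2 Y^2\<close>
  is of higher order than \<open>e^2 x^2 q\<close>. The weight of \<open>x\<close> cancels the terms in \<open>x^4\<close>.
\<close>
definition approx_coeff :: "nat \<Rightarrow> complex \<Rightarrow> 'n option option \<Rightarrow> complex" where
  "approx_coeff n e a = (case a of None \<Rightarrow> - ((of_nat n + 1 / e) / (6 * e ^ 2))
     | Some None \<Rightarrow> 1 / (6 * e ^ 3)
     | Some (Some j) \<Rightarrow> 1 / (6 * e ^ 2))"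

definition approx_linear :: "complex \<Rightarrow> 'n::finite option option \<Rightarrow> 'n option mpoly" where
  "approx_linear e a = (case a of None \<Rightarrow> Var None
     | Some None \<Rightarrow> Var None + smult (- (e ^ 2)) (\<Sum>j\<in>UNIV. Var (Some j))
     | Some (Some j) \<Rightarrow> Var None + smult e (Var (Some j)))"

definition approx :: "complex \<Rightarrow> 'n::finite option mpoly" where
  "approx e = (\<Sum>a\<in>UNIV. smult (approx_coeff CARD('n) e a) (approx_linear e a ^ 4))"

lemma approx_linear_in_forms: "approx_linear e a \<in> forms 1"
  unfolding approx_linear_def
  by (auto split: option.split intro!: vs.subspace_add[OF subspace_forms] vs.subspace_diff[OF subspace_forms] vs.subspace_scale[OF subspace_forms]
      vs.subspace_sum[OF subspace_forms] Var_in_forms[unfolded One_nat_def])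

lemma approx_in_forms: "approx e \<in> forms 4"
proof -
  have "approx_linear e a ^ 4 \<in> forms (4 * 1)" for a
    by (rule forms_power[OF approx_linear_in_forms])
  then show ?thesis
    unfolding approx_def by (intro vs.subspace_sum[OF subspace_forms] vs.subspace_scale[OF subspace_forms]) simp
qed

lemma waring_rank_approx_le: "waring_rank 4 (approx e :: 'n::finite option mpoly) \<le> enat (CARD('n) + 2)"
  using waring_rank_le_card[of "UNIV :: 'n option option set" "approx_linear e" 4 "approx_coeff CARD('n) e"]
  by (simp add: approx_def approx_linear_in_forms[unfolded One_nat_def])

lemma sum_UNIV_option:
  "(\<Sum>a\<in>(UNIV :: 'a::finite option set). f a) = f None + (\<Sum>a\<in>UNIV. f (Some a))"
  by (simp add: UNIV_option_conv sum.reindex)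

lemma coef_approx:
  fixes m :: "'n::finite option \<Rightarrow>\<^sub>0 nat"
  obtains c1 c2 c3 c5 where
    "\<And>e. e \<noteq> 0 \<Longrightarrow> coef (approx e) m = coef sphere_form m + c1 * e + c2 * e ^ 2 + c3 * e ^ 3 + c5 * e ^ 5"
proof -
  let ?x = "Var None :: 'n option mpoly" and ?y = "\<lambda>j. Var (Some j) :: 'n option mpoly"
  let ?Y = "\<Sum>j\<in>UNIV. ?y j"
  define A where "A = coef (?x ^ 4) m"
  define B where "B = (\<Sum>j\<in>UNIV. coef (?x ^ 3 * ?y j) m)"
  define T where "T = (\<Sum>j\<in>UNIV. coef (?x * ?y j ^ 3) m)"
  define U where "U = (\<Sum>j\<in>UNIV. coef (?y j ^ 4) m)"
  have F: "coef sphere_form m = (\<Sum>j\<in>UNIV. coef (?x ^ 2 * ?y j ^ 2) m)"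
    by (simp add: sphere_form_def sum_distrib_left lookup_sum)
  have B': "coef (?x ^ 3 * ?Y) m = B"
    by (simp add: B_def sum_distrib_left lookup_sum)
  define Y2 where "Y2 = coef (?x ^ 2 * ?Y ^ 2) m"
  define Y3 where "Y3 = coef (?x * ?Y ^ 3) m"
  define Y4 where "Y4 = coef (?Y ^ 4) m"
  have "coef (approx e) m = coef sphere_form m + (2 / 3 * T + Y2) * e + (U / 6) * e ^ 2
      + (- 2 / 3 * Y3) * e ^ 3 + (Y4 / 6) * e ^ 5" if e: "e \<noteq> 0" for e
  proof -
    have sum: "(\<Sum>j\<in>UNIV. coef ((?x + smult e (?y j)) ^ 4) m)
        = of_nat CARD('n) * A + 4 * e * B + 6 * e ^ 2 * coef sphere_form m + 4 * e ^ 3 * T + e ^ 4 * U"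
      by (simp add: quartic_power_expand lookup_add sum.distrib A_def B_def F T_def U_def sum_distrib_left)
    have last: "coef ((?x + smult (- (e ^ 2)) ?Y) ^ 4) m
        = A - 4 * e ^ 2 * B + 6 * e ^ 4 * Y2 - 4 * e ^ 6 * Y3 + e ^ 8 * Y4"
      unfolding quartic_power_expand
      by (simp add: lookup_add lookup_minus B' flip: A_def Y2_def Y3_def Y4_def)
    have total: "coef (approx e) m
        = (\<Sum>j\<in>UNIV. coef ((?x + smult e (?y j)) ^ 4) m) / (6 * e ^ 2)
          + coef ((?x + smult (- (e ^ 2)) ?Y) ^ 4) m / (6 * e ^ 3)
          - (of_nat CARD('n) + 1 / e) * A / (6 * e ^ 2)"
      by (simp add: approx_def lookup_sum approx_coeff_def approx_linear_def sum_UNIV_option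
          lookup_add lookup_minus A_def sum_divide_distrib)
    show ?thesis
      unfolding total sum last using e by (simp add: field_simps eval_nat_numeral)
  qed
  then show ?thesis
    by (rule that)
qed

text \<open>
  The definition asks for approximants of Waring rank exactly \<open>n + 2\<close>. The forms \<open>approx e\<close> have at most
  that rank, and for small \<open>e\<close> at least that rank by the lower bound.
\<close>
lemma border_rank_sphere_form: "border_rank 4 (sphere_form :: 'n::finite option mpoly) = enat (CARD('n) + 2)"
proof (rule antisym)
  define \<epsilon> :: "nat \<Rightarrow> complex" where "\<epsilon> k = 1 / of_nat (Suc k)" for k
  have \<epsilon>: "\<epsilon> \<longlonglongrightarrow> 0"
    unfolding \<epsilon>_def by (rule LIMSEQ_Suc[OF lim_1_over_n])
  have lim: "(\<lambda>k. coef (approx (\<epsilon> k)) m) \<longlonglongrightarrow> coef sphere_form m" for m :: "'n option \<Rightarrow>\<^sub>0 nat"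
  proof -
    obtain c1 c2 c3 c5 where c: "\<And>e. e \<noteq> 0 \<Longrightarrow>
        coef (approx e) m = coef sphere_form m + c1 * e + c2 * e ^ 2 + c3 * e ^ 3 + c5 * e ^ 5"
      using coef_approx[of m] by blast
    have "\<epsilon> k \<noteq> 0" for k
      by (simp add: \<epsilon>_def del: of_nat_Suc)
    then have "coef (approx (\<epsilon> k)) m
        = coef sphere_form m + c1 * \<epsilon> k + c2 * \<epsilon> k ^ 2 + c3 * \<epsilon> k ^ 3 + c5 * \<epsilon> k ^ 5" for k
      by (rule c)
    moreover have "(\<lambda>k. coef sphere_form m + c1 * \<epsilon> k + c2 * \<epsilon> k ^ 2 + c3 * \<epsilon> k ^ 3 + c5 * \<epsilon> k ^ 5)
        \<longlonglongrightarrow> coef sphere_form m + c1 * 0 + c2 * 0 ^ 2 + c3 * 0 ^ 3 + c5 * 0 ^ 5"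
      by (intro tendsto_intros \<epsilon>)
    ultimately show ?thesis
      by simp
  qed
  obtain N where N: "\<And>k. N \<le> k \<Longrightarrow> enat (CARD('n) + 2) \<le> waring_rank 4 (approx (\<epsilon> k) :: 'n option mpoly)"
    using eventually_waring_rank_ge[OF lim] by (auto simp: eventually_sequentially)
  have "waring_rank 4 (approx (\<epsilon> (k + N)) :: 'n option mpoly) = enat (CARD('n) + 2)" for k
    by (intro antisym waring_rank_approx_le N) simp
  moreover have "(\<lambda>k. coef (approx (\<epsilon> (k + N))) m) \<longlonglongrightarrow> coef sphere_form m" for m :: "'n option \<Rightarrow>\<^sub>0 nat"
    using lim by (rule LIMSEQ_ignore_initial_segment)
  ultimately show "border_rank 4 (sphere_form :: 'n option mpoly) \<le> enat (CARD('n) + 2)"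
    unfolding border_rank_def
    by (intro Inf_lower CollectI exI[of _ "CARD('n) + 2"] conjI refl
        exI[of _ "\<lambda>k. approx (\<epsilon> (k + N)) :: 'n option mpoly"] allI approx_in_forms)
  show "enat (CARD('n) + 2) \<le> border_rank 4 (sphere_form :: 'n option mpoly)"
    unfolding border_rank_def
  proof (intro Inf_greatest)
    fix s
    assume "s \<in> {enat r | r. \<exists>G :: nat \<Rightarrow> 'n option mpoly.
      (\<forall>k. G k \<in> forms 4 \<and> waring_rank 4 (G k) = enat r) \<and>
      (\<forall>m. (\<lambda>k. coef (G k) m) \<longlonglongrightarrow> coef sphere_form m)}"
    then obtain r and G :: "nat \<Rightarrow> 'n option mpoly" where s: "s = enat r"
        and r: "\<And>k. waring_rank 4 (G k) = enat r" and G: "\<And>m. (\<lambda>k. coef (G k) m) \<longlonglongrightarrow> coef sphere_form m"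
      by auto
    show "enat (CARD('n) + 2) \<le> s"
      using eventually_waring_rank_ge[OF G] by (simp add: r s)
  qed
qed

theorem lemma7p1:
  fixes F :: "'n::finite option mpoly"
  assumes "CARD('n) \<ge> 2"
    and "F = Var None ^ 2 * (\<Sum>j\<in>UNIV. Var (Some j) ^ 2)"
  shows "cactus_rank F = enat (CARD('n) + 2) \<and> border_rank 4 F = enat (CARD('n) + 2)"
  using cactus_rank_sphere_form border_rank_sphere_form assms(2)
  by (simp add: sphere_form_def)

end
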